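(* Let $\Gamma$ and $\Delta$ be distance-regularized graphs. Then $\Gamma$ and $\Delta$ are cospectral if and only if they are $C^3$-equivalent.
   Context: All graphs are finite, undirected, without loops or multiple edges. For a graph $\Gamma=(X,E)$ and a vertex $x\in X$, let $\Gamma_i(x)$ be the set of vertices at distance $i\ge 0$ from $x$. If $\Gamma$ is connected, for $x,y\in X$ with $y\in\Gamma_i(x)$ define $c_i(x,y)=|\Gamma_{i-1}(x)\cap\Gamma_1(y)|$, $a_i(x,y)=|\Gamma_i(x)\cap\Gamma_1(y)|$, $b_i(x,y)=|\Gamma_{i+1}(x)\cap\Gamma_1(y)|$, with $c_0(x,y)=0$. The vertex $x$ is distance-regularized if, for each $i$, the numbers $c_i(x,y),a_i(x,y),b_i(x,y)$ are independent of the choice of $y\in\Gamma_i(x)$ (they may depend on $x$). A distance-regularized graph is a connected graph in which every vertex is distance-regularized. The spectrum of a graph is the multiset of eigenvalues of its adjacency matrix, counted with multiplicities; two graphs are cospectral if they have the same spectrum. Logic: the language of graphs has one binary relation symbol $E$, interpreted as adjacency, and variables range over the vertices. For a positive integer $k$, $C^k$ denotes the fragment of first-order logic (with equality) in which only $k$ distinct variables may be used (variables may be re-quantified), with the usual connectives and quantifiers and, in addition, a counting quantifier $\exists^{\geq i}$ for each positive integer $i$; $\exists^{\geq i}x\,\varphi$ is true if there are at least $i$ distinct vertices that can be substituted for $x$ to make $\varphi$ true. Two graphs are $C^k$-equivalent if they satisfy exactly the same $C^k$-sentences. *)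

theory Defs
  imports
    Complex_Main
    "HOL-Computational_Algebra.Polynomial"
    "Graph_Theory.Pair_Digraph"
    "Graph_Theory.Digraph_Component"
    "Graph_Theory.Shortest_Path"
    "Jordan_Normal_Form.Char_Poly"
begin

text \<open>
  The locale \<open>pair_graph\<close> of the AFP entry \<open>Graph_Theory\<close> describes exactly the finite undirected
  graphs without loops and multiple edges: \<open>pverts G\<close> is a finite vertex set and \<open>parcs G\<close> is a
  symmetric irreflexive relation on it.
\<close>

section \<open>Distance-regularized graphs\<close>

context pair_graph
begin

text \<open>
  \<open>\<Gamma>\<^sub>i(x)\<close>. The distance is the library's infimum \<open>\<mu>\<close> of the costs of walks, where every arc costs 1;
  it is infinite if there is no walk from \<open>x\<close> to \<open>y\<close>.
\<close>

definition sphere :: "nat \<Rightarrow> 'a \<Rightarrow> 'a set" where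
  "sphere i x = {y \<in> pverts G. \<mu> (\<lambda>_. 1) x y = ereal (real i)}"

text \<open>
  These numbers are meant for \<open>y \<in> sphere i x\<close>.
\<close>

definition c_num :: "nat \<Rightarrow> 'a \<Rightarrow> 'a \<Rightarrow> nat" where
  "c_num i x y = (if i = 0 then 0 else card (sphere (i - 1) x \<inter> sphere 1 y))"

definition a_num :: "nat \<Rightarrow> 'a \<Rightarrow> 'a \<Rightarrow> nat" where
  "a_num i x y = card (sphere i x \<inter> sphere 1 y)"

definition b_num :: "nat \<Rightarrow> 'a \<Rightarrow> 'a \<Rightarrow> nat" where
  "b_num i x y = card (sphere (i + 1) x \<inter> sphere 1 y)"

definition distance_regularized_vertex :: "'a \<Rightarrow> bool" where
  "distance_regularized_vertex x \<longleftrightarrow>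
     (\<forall>i. \<forall>y \<in> sphere i x. \<forall>z \<in> sphere i x.
        c_num i x y = c_num i x z \<and> a_num i x y = a_num i x z \<and> b_num i x y = b_num i x z)"

end

locale distance_regularized_graph = pair_graph +
  assumes connected_graph: "Digraph_Component.connected (with_proj G)"
    and distance_regularized: "x \<in> pverts G \<Longrightarrow> distance_regularized_vertex x"

section \<open>Spectrum\<close>

text \<open>
  Rows and columns follow an arbitrary enumeration of the vertices; another one conjugates the
  matrix by a permutation matrix and thus leaves the spectrum unchanged.
\<close>

definition vertex_list :: "'a pair_pre_digraph \<Rightarrow> 'a list" where
  "vertex_list G = (SOME vs. distinct vs \<and> set vs = pverts G)"

definition adjacency_matrix :: "'a pair_pre_digraph \<Rightarrow> complex mat" where
  "adjacency_matrix G = (let vs = vertex_list G; n = length vs in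
     mat n n (\<lambda>(i, j). if (vs ! i, vs ! j) \<in> parcs G then 1 else 0))"

text \<open>
  The matrix is taken over the complex numbers, where the characteristic polynomial splits, so that
  its multiset of roots consists of all eigenvalues with their algebraic multiplicities. (As the
  matrix is real symmetric, the eigenvalues are real and these are also the geometric
  multiplicities.)
\<close>

definition graph_spectrum :: "'a pair_pre_digraph \<Rightarrow> complex multiset" where
  "graph_spectrum G = proots (char_poly (adjacency_matrix G))"

definition cospectral :: "'a pair_pre_digraph \<Rightarrow> 'b pair_pre_digraph \<Rightarrow> bool" where
  "cospectral G H \<longleftrightarrow> graph_spectrum G = graph_spectrum H"

section \<open>First-order logic with counting quantifiers\<close>

text \<open>
  Variables are natural numbers. \<open>AtLeast i x \<phi>\<close> is the counting quantifier with threshold \<open>i\<close>;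
  the requirement \<open>i \<ge> 1\<close> is part of the predicate \<open>is_C\<close> below.
\<close>

datatype fol =
    Adj nat nat
  | Eq nat nat
  | Neg fol
  | Conj fol fol
  | Disj fol fol
  | Imp fol fol
  | Iff fol fol
  | Exi nat fol
  | Uni nat fol
  | AtLeast nat nat fol

primrec free_vars :: "fol \<Rightarrow> nat set" where
  "free_vars (Adj x y) = {x, y}"
| "free_vars (Eq x y) = {x, y}"
| "free_vars (Neg \<phi>) = free_vars \<phi>"
| "free_vars (Conj \<phi> \<psi>) = free_vars \<phi> \<union> free_vars \<psi>"
| "free_vars (Disj \<phi> \<psi>) = free_vars \<phi> \<union> free_vars \<psi>"
| "free_vars (Imp \<phi> \<psi>) = free_vars \<phi> \<union> free_vars \<psi>"
| "free_vars (Iff \<phi> \<psi>) = free_vars \<phi> \<union> free_vars \<psi>"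
| "free_vars (Exi x \<phi>) = free_vars \<phi> - {x}"
| "free_vars (Uni x \<phi>) = free_vars \<phi> - {x}"
| "free_vars (AtLeast i x \<phi>) = free_vars \<phi> - {x}"

text \<open>
  The formulas of \<open>C\<^sup>k\<close>, whose \<open>k\<close> variables are \<open>0, \<dots>, k - 1\<close>.
\<close>

primrec is_C :: "nat \<Rightarrow> fol \<Rightarrow> bool" where
  "is_C k (Adj x y) \<longleftrightarrow> x < k \<and> y < k"
| "is_C k (Eq x y) \<longleftrightarrow> x < k \<and> y < k"
| "is_C k (Neg \<phi>) \<longleftrightarrow> is_C k \<phi>"
| "is_C k (Conj \<phi> \<psi>) \<longleftrightarrow> is_C k \<phi> \<and> is_C k \<psi>"
| "is_C k (Disj \<phi> \<psi>) \<longleftrightarrow> is_C k \<phi> \<and> is_C k \<psi>"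
| "is_C k (Imp \<phi> \<psi>) \<longleftrightarrow> is_C k \<phi> \<and> is_C k \<psi>"
| "is_C k (Iff \<phi> \<psi>) \<longleftrightarrow> is_C k \<phi> \<and> is_C k \<psi>"
| "is_C k (Exi x \<phi>) \<longleftrightarrow> x < k \<and> is_C k \<phi>"
| "is_C k (Uni x \<phi>) \<longleftrightarrow> x < k \<and> is_C k \<phi>"
| "is_C k (AtLeast i x \<phi>) \<longleftrightarrow> i \<ge> 1 \<and> x < k \<and> is_C k \<phi>"

definition C_sentence :: "nat \<Rightarrow> fol \<Rightarrow> bool" where
  "C_sentence k \<phi> \<longleftrightarrow> is_C k \<phi> \<and> free_vars \<phi> = {}"

primrec sat :: "'a pair_pre_digraph \<Rightarrow> (nat \<Rightarrow> 'a) \<Rightarrow> fol \<Rightarrow> bool" where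
  "sat G \<sigma> (Adj x y) \<longleftrightarrow> (\<sigma> x, \<sigma> y) \<in> parcs G"
| "sat G \<sigma> (Eq x y) \<longleftrightarrow> \<sigma> x = \<sigma> y"
| "sat G \<sigma> (Neg \<phi>) \<longleftrightarrow> \<not> sat G \<sigma> \<phi>"
| "sat G \<sigma> (Conj \<phi> \<psi>) \<longleftrightarrow> sat G \<sigma> \<phi> \<and> sat G \<sigma> \<psi>"
| "sat G \<sigma> (Disj \<phi> \<psi>) \<longleftrightarrow> sat G \<sigma> \<phi> \<or> sat G \<sigma> \<psi>"
| "sat G \<sigma> (Imp \<phi> \<psi>) \<longleftrightarrow> (sat G \<sigma> \<phi> \<longrightarrow> sat G \<sigma> \<psi>)"
| "sat G \<sigma> (Iff \<phi> \<psi>) \<longleftrightarrow> (sat G \<sigma> \<phi> \<longleftrightarrow> sat G \<sigma> \<psi>)"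
| "sat G \<sigma> (Exi x \<phi>) \<longleftrightarrow> (\<exists>v \<in> pverts G. sat G (\<sigma>(x := v)) \<phi>)"
| "sat G \<sigma> (Uni x \<phi>) \<longleftrightarrow> (\<forall>v \<in> pverts G. sat G (\<sigma>(x := v)) \<phi>)"
| "sat G \<sigma> (AtLeast i x \<phi>) \<longleftrightarrow> card {v \<in> pverts G. sat G (\<sigma>(x := v)) \<phi>} \<ge> i"

text \<open>
  Truth of a sentence does not depend on the assignment.
\<close>

lemma sat_cong_free_vars:
  "(\<And>x. x \<in> free_vars \<phi> \<Longrightarrow> \<sigma> x = \<tau> x) \<Longrightarrow> sat G \<sigma> \<phi> \<longleftrightarrow> sat G \<tau> \<phi>"
proof (induction \<phi> arbitrary: \<sigma> \<tau>)
  case (Adj x y)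
  have "\<sigma> x = \<tau> x" "\<sigma> y = \<tau> y"
    by (rule Adj.prems, simp)+
  then show ?case by simp
next
  case (Eq x y)
  have "\<sigma> x = \<tau> x" "\<sigma> y = \<tau> y"
    by (rule Eq.prems, simp)+
  then show ?case by simp
next
  case (Neg \<phi>)
  have "sat G \<sigma> \<phi> \<longleftrightarrow> sat G \<tau> \<phi>"
    by (rule Neg.IH, rule Neg.prems, simp)
  then show ?case by simp
next
  case (Conj \<phi> \<psi>)
  have "sat G \<sigma> \<phi> \<longleftrightarrow> sat G \<tau> \<phi>"
    by (rule Conj.IH(1), rule Conj.prems, simp)
  moreover have "sat G \<sigma> \<psi> \<longleftrightarrow> sat G \<tau> \<psi>"
    by (rule Conj.IH(2), rule Conj.prems, simp)
  ultimately show ?case by simp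
next
  case (Disj \<phi> \<psi>)
  have "sat G \<sigma> \<phi> \<longleftrightarrow> sat G \<tau> \<phi>"
    by (rule Disj.IH(1), rule Disj.prems, simp)
  moreover have "sat G \<sigma> \<psi> \<longleftrightarrow> sat G \<tau> \<psi>"
    by (rule Disj.IH(2), rule Disj.prems, simp)
  ultimately show ?case by simp
next
  case (Imp \<phi> \<psi>)
  have "sat G \<sigma> \<phi> \<longleftrightarrow> sat G \<tau> \<phi>"
    by (rule Imp.IH(1), rule Imp.prems, simp)
  moreover have "sat G \<sigma> \<psi> \<longleftrightarrow> sat G \<tau> \<psi>"
    by (rule Imp.IH(2), rule Imp.prems, simp)
  ultimately show ?case by simp
next
  case (Iff \<phi> \<psi>)
  have "sat G \<sigma> \<phi> \<longleftrightarrow> sat G \<tau> \<phi>"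
    by (rule Iff.IH(1), rule Iff.prems, simp)
  moreover have "sat G \<sigma> \<psi> \<longleftrightarrow> sat G \<tau> \<psi>"
    by (rule Iff.IH(2), rule Iff.prems, simp)
  ultimately show ?case by simp
next
  case (Exi x \<phi>)
  have "sat G (\<sigma>(x := v)) \<phi> \<longleftrightarrow> sat G (\<tau>(x := v)) \<phi>" for v
  proof (rule Exi.IH)
    fix y assume "y \<in> free_vars \<phi>"
    then show "(\<sigma>(x := v)) y = (\<tau>(x := v)) y"
      using Exi.prems[of y] by (cases "y = x") simp_all
  qed
  then show ?case by simp
next
  case (Uni x \<phi>)
  have "sat G (\<sigma>(x := v)) \<phi> \<longleftrightarrow> sat G (\<tau>(x := v)) \<phi>" for v
  proof (rule Uni.IH)
    fix y assume "y \<in> free_vars \<phi>"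
    then show "(\<sigma>(x := v)) y = (\<tau>(x := v)) y"
      using Uni.prems[of y] by (cases "y = x") simp_all
  qed
  then show ?case by simp
next
  case (AtLeast i x \<phi>)
  have "sat G (\<sigma>(x := v)) \<phi> \<longleftrightarrow> sat G (\<tau>(x := v)) \<phi>" for v
  proof (rule AtLeast.IH)
    fix y assume "y \<in> free_vars \<phi>"
    then show "(\<sigma>(x := v)) y = (\<tau>(x := v)) y"
      using AtLeast.prems[of y] by (cases "y = x") simp_all
  qed
  then show ?case by simp
qed

definition satisfies :: "'a pair_pre_digraph \<Rightarrow> fol \<Rightarrow> bool" where
  "satisfies G \<phi> \<longleftrightarrow> (\<forall>\<sigma>. sat G \<sigma> \<phi>)"

definition C_equivalent :: "nat \<Rightarrow> 'a pair_pre_digraph \<Rightarrow> 'b pair_pre_digraph \<Rightarrow> bool" where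
  "C_equivalent k G H \<longleftrightarrow> (\<forall>\<phi>. C_sentence k \<phi> \<longrightarrow> (satisfies G \<phi> \<longleftrightarrow> satisfies H \<phi>))"

end

(*
  Both cospectrality and C^3-equivalence are compared with the numbers of closed walks of each length,
  which are the power sums of the spectrum. A C^3-type of a pair of vertices determines the number of
  walks of each length between them, because one more variable suffices to split a walk at its last
  arc; hence C^3-equivalent graphs have equally many closed walks.

  Conversely, in a distance-regularized graph the valencies of adjacent vertices have a constant sum S
  and a constant product P. The growth of the numbers of closed walks determines P, and
  S = nP/e for n vertices and e > 0 edges.
  The closed walks at x are proportional to the valency of x, so they are determined by the spectrum
  and this valency. The Gram matrix of the walks starting at x then yields the intersection array of x,
  row by row. Finally, the intersection arrays of x and y and their distance determine the numbers of
  vertices at given distances from x and y, which is what Duplicator needs in the pebble game.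
*)

theory Submission
  imports Defs "Jordan_Normal_Form.Schur_Decomposition" "HOL-Analysis.Convex"
begin

section \<open>Power sums of the spectrum\<close>

text \<open>\<open>S\<close> and \<open>P\<close> exist because the valency of a neighbour of
  \<open>x\<close> is a row sum of the intersection array of \<open>x\<close>: all neighbours of a
  vertex have the same valency, so valencies alternate along every walk and take at most two values.
  The graph need not be regular, and this is the obstacle: vertices of different valency have
  different arrays, so no single array describes the graph, and the spectrum does not say which
  vertices of the two graphs correspond. The valency is the missing label. Since \<open>S\<close>
  and \<open>P\<close> fix the two valencies up to order, some vertex of one graph has the valency
  of some vertex of the other, and one such pair is enough to start the game. \<open>S\<close> is
  needed again inside a single array. The closed walks at \<open>x\<close> alone determine a_i and
  only the products b_i c_(i+1). If the degree at distance i is known, then c_i and a_i give b_i,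
  and the product gives c_(i+1). This degree is \<open>valency x\<close> or
  \<open>S - valency x\<close>, according to the parity of i.\<close>

primrec nwalks :: "'a pair_pre_digraph \<Rightarrow> nat \<Rightarrow> 'a \<Rightarrow> 'a \<Rightarrow> nat" where
  "nwalks G 0 x y = (if x = y then 1 else 0)"
| "nwalks G (Suc l) x y = (\<Sum>z | z \<in> pverts G \<and> (z, y) \<in> parcs G. nwalks G l x z)"

definition closed_walks :: "'a pair_pre_digraph \<Rightarrow> nat \<Rightarrow> nat" where
  "closed_walks G l = (\<Sum>x\<in>pverts G. nwalks G l x x)"

section \<open>Traces of matrix powers\<close>

lemma upper_triangular_mult:
  fixes A B :: "'a :: semiring_0 mat"
  assumes A: "A \<in> carrier_mat n n" "upper_triangular A" and B: "B \<in> carrier_mat n n" "upper_triangular B"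
  shows "upper_triangular (A * B)" "i < n \<Longrightarrow> (A * B) $$ (i, i) = A $$ (i, i) * B $$ (i, i)"
proof -
  have e: "(A * B) $$ (i, j) = (\<Sum>k<n. A $$ (i, k) * B $$ (k, j))" if "i < n" "j < n" for i j
    using that A B by (simp add: scalar_prod_def lessThan_atLeast0)
  have z: "A $$ (i, k) * B $$ (k, j) = 0" if "i < n" "j < n" "k < n" "k < i \<or> j < k" for i j k
  proof (cases "k < i")
    case True
    then show ?thesis using upper_triangularD[OF A(2) True] A(1) that by auto
  next
    case False
    then have "j < k" using that by auto
    then show ?thesis using upper_triangularD[OF B(2) \<open>j < k\<close>] B(1) that by auto
  qed
  show "upper_triangular (A * B)"
  proof
    fix i j assume ij: "j < i" "i < dim_row (A * B)"
    then have "i < n" "j < n" using A by auto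
    then show "(A * B) $$ (i, j) = 0"
      unfolding e[OF \<open>i < n\<close> \<open>j < n\<close>] by (intro sum.neutral ballI z) (use ij in auto)
  qed
  show "(A * B) $$ (i, i) = A $$ (i, i) * B $$ (i, i)" if i: "i < n"
  proof -
    have "(\<Sum>k<n. A $$ (i, k) * B $$ (k, i)) = (\<Sum>k<n. if k = i then A $$ (i, i) * B $$ (i, i) else 0)"
      by (rule sum.cong) (use z[of i i] i in \<open>auto simp: not_less_iff_gr_or_eq dest: le_neq_implies_less\<close>, metis linorder_neqE_nat)
    then show ?thesis using e[OF i i] i by simp
  qed
qed

lemma upper_triangular_pow:
  fixes B :: "'a :: semiring_1 mat"
  assumes B: "B \<in> carrier_mat n n" "upper_triangular B"
  shows "upper_triangular (B ^\<^sub>m l) \<and> (\<forall>i<n. (B ^\<^sub>m l) $$ (i, i) = B $$ (i, i) ^ l)"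
proof (induction l)
  case (Suc l)
  have c: "B ^\<^sub>m l \<in> carrier_mat n n" using B by simp
  show ?case using upper_triangular_mult[OF c _ B] Suc by (simp add: power_commutes)
qed (use B in auto)

lemma trace_commute:
  fixes A B :: "'a :: comm_semiring_0 mat"
  assumes "A \<in> carrier_mat n n" "B \<in> carrier_mat n n"
  shows "(\<Sum>i<n. (A * B) $$ (i, i)) = (\<Sum>i<n. (B * A) $$ (i, i))"
proof -
  have "(\<Sum>i<n. (A * B) $$ (i, i)) = (\<Sum>i<n. \<Sum>k<n. A $$ (i, k) * B $$ (k, i))"
    using assms by (simp add: scalar_prod_def lessThan_atLeast0)
  also have "\<dots> = (\<Sum>k<n. \<Sum>i<n. B $$ (k, i) * A $$ (i, k))"
    by (subst sum.swap) (simp add: mult.commute)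
  also have "\<dots> = (\<Sum>i<n. (B * A) $$ (i, i))"
    using assms by (simp add: scalar_prod_def lessThan_atLeast0)
  finally show ?thesis .
qed

text \<open>Schur triangularization gives \<open>A = P B Q\<close> with \<open>Q P = 1\<close> and
  the roots of the characteristic polynomial on the diagonal of \<open>B\<close>. Powers are
  conjugated in the same way, the trace is cyclic, and the diagonal of \<open>B ^\<^sub>m l\<close>
  consists of \<open>l\<close>-th powers.\<close>

lemma trace_pow_proots:
  fixes A :: "complex mat"
  assumes A: "A \<in> carrier_mat n n"
  shows "(\<Sum>i<n. (A ^\<^sub>m l) $$ (i, i)) = (\<Sum>z\<in>#proots (char_poly A). z ^ l)"
proof -
  obtain es where es: "char_poly A = (\<Prod>a\<leftarrow>es. [:- a, 1:])"
    using char_poly_factorized[OF A] by blast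
  obtain B P Q where "schur_decomposition A es = (B, P, Q)" by (metis prod_cases3)
  from schur_decomposition[OF A es this]
  have w: "similar_mat_wit A B P Q" and ut: "upper_triangular B" and d: "diag_mat B = es" by auto
  note wit = similar_mat_witD2[OF A w]
  have Bl: "B ^\<^sub>m l \<in> carrier_mat n n" using wit by simp
  have "(\<Sum>i<n. (A ^\<^sub>m l) $$ (i, i)) = (\<Sum>i<n. (P * (B ^\<^sub>m l * Q)) $$ (i, i))"
    using similar_mat_wit_pow_id[OF w, of l] assoc_mult_mat[OF _ Bl] wit by metis
  also have "\<dots> = (\<Sum>i<n. (B ^\<^sub>m l * Q * P) $$ (i, i))"
    using wit Bl by (intro trace_commute) auto
  also have "B ^\<^sub>m l * Q * P = B ^\<^sub>m l * (Q * P)"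
    using wit Bl by (intro assoc_mult_mat) auto
  also have "\<dots> = B ^\<^sub>m l" using wit Bl by simp
  also have "(\<Sum>i<n. (B ^\<^sub>m l) $$ (i, i)) = (\<Sum>i<n. B $$ (i, i) ^ l)"
    using upper_triangular_pow[OF _ ut, of n l] wit by simp
  also have "\<dots> = sum_list (map (\<lambda>z. z ^ l) es)"
    unfolding d[symmetric] using wit
    by (simp add: diag_mat_def o_def sum_list_sum_nth lessThan_atLeast0)
  also have "\<dots> = (\<Sum>z\<in>#mset es. z ^ l)" by (metis mset_map sum_mset_sum_list)
  also have "mset es = proots (char_poly A)"
  proof -
    have "proots (\<Prod>a\<leftarrow>es. [:- a, 1:]) = mset es"
    proof (induction es)
      case (Cons a es)
      have "(\<Prod>a\<leftarrow>es. [:- a, 1:]) \<noteq> (0 :: complex poly)" by (auto simp: prod_list_zero_iff)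
      then show ?case using Cons by (simp add: proots_mult del: mult_pCons_left)
    qed simp
    then show ?thesis using es by simp
  qed
  finally show ?thesis .
qed

text \<open>A polynomial \<open>p\<close> that vanishes at all other elements isolates
  \<open>a\<close>: its sum over a multiset is \<open>poly p a\<close> times the multiplicity of
  \<open>a\<close>, and also a fixed linear combination of power sums.\<close>

lemma mset_eqI_power_sums:
  fixes M N :: "'a :: field_char_0 multiset"
  assumes eq: "\<And>l. (\<Sum>z\<in>#M. z ^ l) = (\<Sum>z\<in>#N. z ^ l)"
  shows "M = N"
proof (rule multiset_eqI)
  fix a
  define S where "S = set_mset M \<union> set_mset N - {a}"
  define p where "p = (\<Prod>b\<in>S. [:- b, 1:])"
  have S: "finite S" by (simp add: S_def)
  have p0: "poly p b = 0 \<longleftrightarrow> b \<in> S" for b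
    using S by (auto simp: p_def poly_prod)
  have P: "(\<Sum>z\<in>#X. poly p z) = of_nat (count X a) * poly p a" if "set_mset X \<subseteq> insert a S" for X
    using that
  proof (induction X)
    case (add x X)
    then show ?case by (cases "x = a") (auto simp: p0 algebra_simps)
  qed simp
  have Q: "(\<Sum>z\<in>#X. poly p z) = (\<Sum>l\<le>degree p. coeff p l * (\<Sum>z\<in>#X. z ^ l))" for X
    by (induction X) (simp_all add: poly_altdef sum.distrib algebra_simps)
  have "of_nat (count M a) * poly p a = of_nat (count N a) * poly p a"
    using P[of M] P[of N] Q[of M] Q[of N] eq by (simp add: S_def subset_insertI2 le_supI1 subset_iff)
  moreover have "poly p a \<noteq> 0" by (simp add: p0 S_def)
  ultimately show "count M a = count N a" by simp
qed

lemma closed_walks_spectrum: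
  assumes fin: "finite (pverts G)"
  shows "of_nat (closed_walks G l) = (\<Sum>z\<in>#graph_spectrum G. z ^ l)"
proof -
  define vs where "vs = vertex_list G"
  define n where "n = length vs"
  define A where "A = adjacency_matrix G"
  have "\<exists>vs. distinct vs \<and> set vs = pverts G" using finite_distinct_list[OF fin] by blast
  then have vs: "distinct vs" "set vs = pverts G"
    unfolding vs_def vertex_list_def by (metis (mono_tags, lifting) someI_ex)+
  have bij: "bij_betw (\<lambda>i. vs ! i) {..<n} (pverts G)"
    using bij_betw_nth[OF vs(1)] vs(2) by (simp add: n_def)
  have A: "A = mat n n (\<lambda>(i, j). if (vs ! i, vs ! j) \<in> parcs G then 1 else 0)"
    by (simp add: A_def adjacency_matrix_def vs_def n_def Let_def)
  have Ac: "A \<in> carrier_mat n n" by (simp add: A)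
  have pow: "(A ^\<^sub>m l) $$ (i, j) = of_nat (nwalks G l (vs ! i) (vs ! j))" if "i < n" "j < n" for i j
    using that
  proof (induction l arbitrary: j)
    case 0
    then show ?case using Ac vs(1) by (simp add: nth_eq_iff_index_eq n_def)
  next
    case (Suc l)
    have Al: "A ^\<^sub>m l \<in> carrier_mat n n" using Ac by simp
    have "(A ^\<^sub>m Suc l) $$ (i, j) = (\<Sum>k<n. (A ^\<^sub>m l) $$ (i, k) * A $$ (k, j))"
      using Suc.prems Al Ac by (simp add: scalar_prod_def lessThan_atLeast0)
    also have "\<dots> = (\<Sum>k<n. if (vs ! k, vs ! j) \<in> parcs G then of_nat (nwalks G l (vs ! i) (vs ! k)) else 0)"
      using Suc by (intro sum.cong) (auto simp: A)
    also have "\<dots> = (\<Sum>z\<in>pverts G. if (z, vs ! j) \<in> parcs G then of_nat (nwalks G l (vs ! i) z) else 0)"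
      by (rule sum.reindex_bij_betw[OF bij])
    also have "\<dots> = of_nat (nwalks G (Suc l) (vs ! i) (vs ! j))"
      using fin by (simp add: sum.inter_filter if_distrib[of of_nat] cong: if_cong)
    finally show ?case .
  qed
  have "(\<Sum>i<n. (A ^\<^sub>m l) $$ (i, i)) = (\<Sum>i<n. of_nat (nwalks G l (vs ! i) (vs ! i)))"
    by (intro sum.cong) (simp_all add: pow del: nwalks.simps)
  also have "\<dots> = of_nat (closed_walks G l)"
    unfolding closed_walks_def of_nat_sum by (rule sum.reindex_bij_betw[OF bij])
  finally show ?thesis
    using trace_pow_proots[OF Ac, of l] by (simp add: graph_spectrum_def A_def)
qed

lemma cospectral_iff_closed_walks:
  assumes "finite (pverts G)" "finite (pverts H)"
  shows "cospectral G H \<longleftrightarrow> (\<forall>l. closed_walks G l = closed_walks H l)"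
proof
  assume "cospectral G H"
  then have "(of_nat (closed_walks G l) :: complex) = of_nat (closed_walks H l)" for l
    unfolding closed_walks_spectrum[OF assms(1)] closed_walks_spectrum[OF assms(2)]
    by (simp add: cospectral_def)
  then show "\<forall>l. closed_walks G l = closed_walks H l" by simp
next
  assume "\<forall>l. closed_walks G l = closed_walks H l"
  then show "cospectral G H"
    unfolding cospectral_def
    by (intro mset_eqI_power_sums) (simp flip: closed_walks_spectrum[OF assms(1)] closed_walks_spectrum[OF assms(2)])
qed

section \<open>Intersection arrays and closed walks\<close>

text \<open>Meant for an \<open>n\<close> above every distance from the base vertex; the cut-off of
  the sum then loses nothing.\<close>

primrec array_walks :: "nat \<Rightarrow> (nat \<Rightarrow> nat \<Rightarrow> nat) \<Rightarrow> nat \<Rightarrow> nat \<Rightarrow> nat" where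
  "array_walks n M 0 j = (if j = 0 then 1 else 0)"
| "array_walks n M (Suc l) j = (\<Sum>i<n. M j i * array_walks n M l i)"

text \<open>
  The intersection array seen from one vertex \<open>x\<close>: \<open>M j i\<close> is the number of neighbours at distance
  \<open>i\<close> from \<open>x\<close> of a vertex at distance \<open>j\<close> from \<open>x\<close>, so that \<open>M j (j - 1)\<close>, \<open>M j j\<close>, \<open>M j (j + 1)\<close>
  are \<open>c\<^sub>j\<close>, \<open>a\<^sub>j\<close>, \<open>b\<^sub>j\<close>; \<open>K j\<close> is the size of the \<open>j\<close>-th sphere, \<open>D j\<close> the degree of its
  vertices and \<open>W l j\<close> the number of walks of length \<open>l\<close> from \<open>x\<close> to one of them. The rows of an
  empty sphere are 0.
\<close>

locale local_array =
  fixes n :: nat and M :: "nat \<Rightarrow> nat \<Rightarrow> nat" and K D :: "nat \<Rightarrow> nat" and W :: "nat \<Rightarrow> nat \<Rightarrow> nat"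
  assumes tridiagonal: "i > Suc j \<or> j > Suc i \<Longrightarrow> M j i = 0"
    and symmetric: "K i * M i j = K j * M j i"
    and row_sum: "K j > 0 \<Longrightarrow> (\<Sum>i<n. M j i) = D j"
    and K_0: "K 0 = 1"
    and M_pred: "K (Suc j) > 0 \<Longrightarrow> M (Suc j) j > 0"
    and M_empty: "K j = 0 \<Longrightarrow> M j i = 0"
    and K_bound: "j \<ge> n \<Longrightarrow> K j = 0"
    and W_0: "W 0 j = (if j = 0 then 1 else 0)"
    and W_Suc: "W (Suc l) j = (\<Sum>i<n. M j i * W l i)"
begin

lemma W_zero: "l < j \<Longrightarrow> W l j = 0"
proof (induction l arbitrary: j)
  case (Suc l)
  then have "M j i * W l i = 0" for i using tridiagonal[of j i] by (cases "l < i") auto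
  then show ?case by (simp add: W_Suc)
qed (simp add: W_0)

text \<open>A walk of length \<open>Suc i\<close> that ends at distance \<open>Suc i\<close> is a
  geodesic, so its last step starts at distance \<open>i\<close>.\<close>

lemma W_diag: "K (Suc i) > 0 \<Longrightarrow> W (Suc i) (Suc i) = M (Suc i) i * W i i"
proof -
  assume K: "K (Suc i) > 0"
  have "Suc i < n" using K K_bound[of "Suc i"] by (cases "Suc i < n") auto
  have "W (Suc i) (Suc i) = (\<Sum>m<n. if m = i then M (Suc i) i * W i i else 0)"
    unfolding W_Suc
  proof (rule sum.cong)
    show "M (Suc i) m * W i m = (if m = i then M (Suc i) i * W i i else 0)" for m
      using W_zero[of i m] tridiagonal[of "Suc i" m] by (cases "m < i"; cases "m = i") auto
  qed simp
  then show ?thesis using \<open>Suc i < n\<close> by simp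
qed

lemma K_pred: "K (Suc i) > 0 \<Longrightarrow> K i > 0"
  using symmetric[of "Suc i" i] M_pred[of i] by (cases "K i") auto

lemma W_diag_pos: "K i > 0 \<Longrightarrow> W i i > 0"
proof (induction i)
  case (Suc i)
  then show ?case using K_pred[of i] M_pred[of i] by (simp add: W_diag)
qed (simp add: W_0)

text \<open>The right-hand side is the Gram matrix of the vectors \<open>W l\<close> for the weights
  \<open>K\<close>. By \<open>symmetric\<close>, \<open>M\<close> is self-adjoint for these weights,
  so a step can be moved from one factor to the other.\<close>

lemma W_add: "W (l + m) 0 = (\<Sum>i<n. K i * W l i * W m i)"
proof (induction m arbitrary: l)
  case 0
  have "n > 0" using K_0 K_bound[of 0] by (cases n) auto
  then have "(\<Sum>i<n. K i * W l i * W 0 i) = (\<Sum>i<n. if i = 0 then W l 0 else 0)"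
    by (intro sum.cong) (auto simp: W_0 K_0)
  then show ?case using \<open>n > 0\<close> by simp
next
  case (Suc m)
  have "W (l + Suc m) 0 = (\<Sum>i<n. K i * W (Suc l) i * W m i)"
    using Suc[of "Suc l"] by simp
  also have "\<dots> = (\<Sum>i<n. \<Sum>j<n. K i * M i j * W l j * W m i)"
    by (simp add: W_Suc sum_distrib_left sum_distrib_right mult.assoc)
  also have "\<dots> = (\<Sum>j<n. \<Sum>i<n. K j * M j i * W l j * W m i)"
    by (subst sum.swap) (simp add: symmetric)
  also have "\<dots> = (\<Sum>j<n. K j * W l j * W (Suc m) j)"
    by (simp add: W_Suc sum_distrib_left sum_distrib_right algebra_simps)
  finally show ?case .
qed

end

lemma sum_cancel:
  fixes f g :: "nat \<Rightarrow> nat"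
  assumes "i < n" "(\<Sum>m<n. f m) = (\<Sum>m<n. g m)" "\<And>m. m \<noteq> i \<Longrightarrow> f m = g m"
  shows "f i = g i"
proof -
  have "(\<Sum>m\<in>{..<n} - {i}. f m) = (\<Sum>m\<in>{..<n} - {i}. g m)"
    using assms(3) by (intro sum.cong) auto
  then show ?thesis using assms(1,2) by (simp add: sum.remove[of "{..<n}" i])
qed

text \<open>
  The functions \<open>W l\<close> are the orthogonal polynomials of the functional \<open>l \<mapsto> W l 0\<close>, and the entries of
  \<open>M\<close> their recurrence coefficients; the degrees \<open>D\<close> split the products \<open>b\<^sub>i c\<^sub>i\<^sub>+\<^sub>1\<close>.
\<close>

locale local_array_pair =
  X: local_array n M K D W + Y: local_array n M' K' D W' for n M K D W M' K' W' +
  assumes closed: "W l 0 = W' l 0"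
begin

text \<open>The inner product of \<open>W (Suc i)\<close> and \<open>W i\<close> yields
  \<open>M i i\<close>, the degree then \<open>M i (Suc i)\<close>, symmetry the product of
  \<open>K (Suc i)\<close> and \<open>M (Suc i) i\<close>, and the norm of \<open>W (Suc i)\<close>
  separates these two factors. This is exactly the part of row \<open>Suc i\<close> that the next
  step starts from.\<close>

lemma agree:
  "(\<forall>j\<le>i. K j = K' j) \<and> (\<forall>j<i. M j = M' j) \<and> (\<forall>m<i. M i m = M' i m)"
proof (induction i)
  case 0
  show ?case using X.K_0 Y.K_0 by simp
next
  case (Suc i)
  note IH = Suc
  have Ki: "K' i = K i" using IH by simp
  show ?case
  proof (cases "K i = 0")
    case True
    then have "K (Suc i) = 0" "K' (Suc i) = 0"
      using X.K_pred[of i] Y.K_pred[of i] Ki by auto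
    then have KS: "K (Suc i) = K' (Suc i)" and "M (Suc i) m = M' (Suc i) m" for m
      by (simp_all add: X.M_empty Y.M_empty)
    moreover have "M i = M' i"
      using True Ki by (simp add: fun_eq_iff X.M_empty Y.M_empty)
    ultimately show ?thesis using IH unfolding le_Suc_eq less_Suc_eq by blast
  next
    case False
    then have K: "K i > 0" "K' i > 0" using Ki by auto
    have n: "i < n" using K X.K_bound[of i] by (cases "i < n") auto
    have W: "W l j = W' l j" if "l \<le> i" for l j
      using that
    proof (induction l arbitrary: j)
      case (Suc l)
      show ?case
      proof (cases "Suc l < j")
        case True
        then show ?thesis by (simp add: X.W_zero Y.W_zero)
      next
        case False
        \<comment> \<open>Here \<open>j \<le> Suc l \<le> i\<close> and only
          \<open>m \<le> l\<close> contributes, so row \<open>i\<close> is read only left of its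
          diagonal.\<close>
        have "M j m * W l m = M' j m * W' l m" for m
        proof (cases "m \<le> l")
          case True
          then have "M j m = M' j m" using IH False Suc.prems by (cases "j < i"; cases "j = i") auto
          then show ?thesis using Suc by simp
        qed (simp add: X.W_zero Y.W_zero)
        then show ?thesis by (simp add: X.W_Suc Y.W_Suc)
      qed
    qed (simp add: X.W_0 Y.W_0)
    have W1: "W (Suc i) j = W' (Suc i) j" if "j < i" for j
      using IH that W[of i] by (simp add: X.W_Suc Y.W_Suc)
    have Wii: "W i i > 0" using X.W_diag_pos K by simp
    \<comment> \<open>A Gram entry with one unknown: terms with \<open>m > i\<close> vanish through
      \<open>W i m\<close>, terms with \<open>m < i\<close> agree by \<open>W1\<close>.\<close>
    have "(\<Sum>m<n. K m * W (Suc i) m * W i m) = (\<Sum>m<n. K' m * W' (Suc i) m * W' i m)"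
      using X.W_add[of "Suc i" i] Y.W_add[of "Suc i" i] closed by metis
    moreover have "K m * W (Suc i) m * W i m = K' m * W' (Suc i) m * W' i m" if "m \<noteq> i" for m
      using that IH W1[of m] W[of i m] by (cases "m < i") (auto simp: X.W_zero Y.W_zero)
    ultimately have "K i * W (Suc i) i * W i i = K' i * W' (Suc i) i * W' i i"
      by (rule sum_cancel[OF n])
    then have W2: "W (Suc i) i = W' (Suc i) i" using K Ki Wii W[of i i] by simp
    have "(\<Sum>m<n. M i m * W i m) = (\<Sum>m<n. M' i m * W' i m)"
      using W2 by (simp add: X.W_Suc Y.W_Suc)
    moreover have "M i m * W i m = M' i m * W' i m" if "m \<noteq> i" for m
      using that IH W[of i m] by (cases "m < i") (auto simp: X.W_zero Y.W_zero)
    ultimately have "M i i * W i i = M' i i * W' i i"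
      by (rule sum_cancel[OF n])
    then have Mii: "M i i = M' i i" using W[of i i] Wii by simp
    have Mle: "M i m = M' i m" if "m \<noteq> Suc i" for m
      using that IH Mii X.tridiagonal[of i m] Y.tridiagonal[of i m]
      by (cases "m < i"; cases "m = i") auto
    \<comment> \<open>If \<open>Suc i = n\<close>, the row sum does not reach this entry; it is 0 by
      symmetry, since the next sphere is empty.\<close>
    have MSuc: "M i (Suc i) = M' i (Suc i)"
    proof (cases "Suc i < n")
      case True
      have "(\<Sum>m<n. M i m) = (\<Sum>m<n. M' i m)"
        using X.row_sum[OF K(1)] Y.row_sum[OF K(2)] by simp
      from sum_cancel[OF True this Mle] show ?thesis .
    next
      case False
      then have "K (Suc i) = 0" "K' (Suc i) = 0" using X.K_bound Y.K_bound by auto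
      then show ?thesis using X.symmetric[of i "Suc i"] Y.symmetric[of i "Suc i"] K by auto
    qed
    have Mi: "M i = M' i" using Mle MSuc by (metis ext)
    have prod: "K (Suc i) * M (Suc i) i = K' (Suc i) * M' (Suc i) i"
      using X.symmetric[of i "Suc i"] Y.symmetric[of i "Suc i"] MSuc Ki by simp
    have zero: "K (Suc i) = 0 \<longleftrightarrow> K' (Suc i) = 0"
      using prod X.M_pred[of i] Y.M_pred[of i] by (metis mult_is_0 neq0_conv)
    have KM: "K (Suc i) = K' (Suc i) \<and> M (Suc i) i = M' (Suc i) i"
    proof (cases "K (Suc i) = 0")
      case True
      then show ?thesis using zero X.M_empty Y.M_empty by simp
    next
      case False
      then have KS: "K (Suc i) > 0" "K' (Suc i) > 0" using zero by auto
      have nS: "Suc i < n" using KS X.K_bound[of "Suc i"] by (cases "Suc i < n") auto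
      \<comment> \<open>The only new term is \<open>K (Suc i)\<close> times the square of
        \<open>M (Suc i) i * W i i\<close>; the known product \<open>prod\<close> cancels, leaving
        \<open>M (Suc i) i\<close>.\<close>
      have "(\<Sum>m<n. K m * W (Suc i) m * W (Suc i) m) = (\<Sum>m<n. K' m * W' (Suc i) m * W' (Suc i) m)"
        using X.W_add[of "Suc i" "Suc i"] Y.W_add[of "Suc i" "Suc i"] closed by metis
      moreover have "K m * W (Suc i) m * W (Suc i) m = K' m * W' (Suc i) m * W' (Suc i) m"
        if "m \<noteq> Suc i" for m
        using that IH W1[of m] W2 by (cases "m < i"; cases "m = i") (auto simp: X.W_zero Y.W_zero)
      ultimately have "K (Suc i) * W (Suc i) (Suc i) * W (Suc i) (Suc i)
          = K' (Suc i) * W' (Suc i) (Suc i) * W' (Suc i) (Suc i)"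
        by (rule sum_cancel[OF nS])
      then have "(K (Suc i) * M (Suc i) i) * (M (Suc i) i * (W i i * W i i))
          = (K' (Suc i) * M' (Suc i) i) * (M' (Suc i) i * (W i i * W i i))"
        using X.W_diag[OF KS(1)] Y.W_diag[OF KS(2)] W[of i i] by (simp add: ac_simps)
      moreover have "K' (Suc i) * M' (Suc i) i > 0"
        using KS(2) Y.M_pred[OF KS(2)] by simp
      ultimately have "M (Suc i) i = M' (Suc i) i"
        unfolding prod using Wii by simp
      then show ?thesis using prod X.M_pred[OF KS(1)] by simp
    qed
    have low: "M (Suc i) m = M' (Suc i) m" if "m < i" for m
      using that X.tridiagonal[of "Suc i" m] Y.tridiagonal[of "Suc i" m] by simp
    show ?thesis using IH Mi KM low unfolding le_Suc_eq less_Suc_eq by blast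
  qed
qed

lemma K_eq: "K = K'"
  using agree by (intro ext) blast

lemma M_eq: "M = M'"
proof
  show "M j = M' j" for j using agree[of "Suc j"] by blast
qed

end

section \<open>Counting logic and pebble games\<close>

text \<open>Bijections between corresponding fibres are glued. This turns equal counts of vertices
  into Duplicator's moves.\<close>

lemma bij_betw_of_card_fibres:
  assumes fin: "finite A" "finite B"
    and card: "\<And>t. card {a \<in> A. p a = t} = card {b \<in> B. q b = t}"
  shows "\<exists>h. bij_betw h A B \<and> (\<forall>a\<in>A. q (h a) = p a)"
proof -
  have "\<exists>h. bij_betw h {a \<in> A. p a = t} {b \<in> B. q b = t}" for t
    using fin card by (intro finite_same_card_bij) auto
  then obtain H where H: "\<And>t. bij_betw (H t) {a \<in> A. p a = t} {b \<in> B. q b = t}" by metis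
  define h where "h a = H (p a) a" for a
  have hB: "h a \<in> B \<and> q (h a) = p a" if "a \<in> A" for a
    using bij_betwE[OF H[of "p a"]] that by (auto simp: h_def)
  moreover have "inj_on h A"
  proof (rule inj_onI)
    fix a b assume ab: "a \<in> A" "b \<in> A" "h a = h b"
    then have "p a = p b" using hB by metis
    then show "a = b"
      using ab bij_betw_imp_inj_on[OF H[of "p a"]] by (auto simp: h_def inj_on_def)
  qed
  moreover have "B \<subseteq> h ` A"
  proof
    fix b assume "b \<in> B"
    then have "b \<in> H (q b) ` {a \<in> A. p a = q b}" using bij_betw_imp_surj_on[OF H[of "q b"]] by auto
    then obtain a where "a \<in> A" "p a = q b" "b = H (q b) a" by auto
    then have "b = h a" by (simp add: h_def)
    then show "b \<in> h ` A" using \<open>a \<in> A\<close> by blast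
  qed
  ultimately show ?thesis by (intro exI[of _ h]) (auto simp: bij_betw_def)
qed

text \<open>The bijective pebble game, with \<open>R\<close> for the positions that Duplicator can
  hold. As \<open>h\<close> is chosen before \<open>v\<close>, it maps the set of vertices
  satisfying a formula onto the corresponding set of the other graph, which preserves the size as
  \<open>AtLeast\<close> demands.\<close>

lemma sat_invariant:
  assumes atomic: "\<And>\<sigma> \<tau> x y. R \<sigma> \<tau> \<Longrightarrow> x < k \<Longrightarrow> y < k \<Longrightarrow>
      (\<sigma> x = \<sigma> y \<longleftrightarrow> \<tau> x = \<tau> y) \<and> ((\<sigma> x, \<sigma> y) \<in> parcs G \<longleftrightarrow> (\<tau> x, \<tau> y) \<in> parcs H)"
    and move: "\<And>\<sigma> \<tau> x. R \<sigma> \<tau> \<Longrightarrow> x < k \<Longrightarrow>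
      \<exists>h. bij_betw h (pverts G) (pverts H) \<and> (\<forall>v\<in>pverts G. R (\<sigma>(x := v)) (\<tau>(x := h v)))"
  shows "is_C k \<phi> \<Longrightarrow> R \<sigma> \<tau> \<Longrightarrow> sat G \<sigma> \<phi> \<longleftrightarrow> sat H \<tau> \<phi>"
proof (induction \<phi> arbitrary: \<sigma> \<tau>)
  case (Exi x \<phi>)
  obtain h where h: "bij_betw h (pverts G) (pverts H)"
    and "\<forall>v\<in>pverts G. R (\<sigma>(x := v)) (\<tau>(x := h v))" using move[OF Exi.prems(2)] Exi.prems(1) by auto
  then have "\<forall>v\<in>pverts G. sat G (\<sigma>(x := v)) \<phi> \<longleftrightarrow> sat H (\<tau>(x := h v)) \<phi>"
    using Exi by auto
  then show ?case by (auto simp flip: bij_betw_imp_surj_on[OF h])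
next
  case (Uni x \<phi>)
  obtain h where h: "bij_betw h (pverts G) (pverts H)"
    and "\<forall>v\<in>pverts G. R (\<sigma>(x := v)) (\<tau>(x := h v))" using move[OF Uni.prems(2)] Uni.prems(1) by auto
  then have "\<forall>v\<in>pverts G. sat G (\<sigma>(x := v)) \<phi> \<longleftrightarrow> sat H (\<tau>(x := h v)) \<phi>"
    using Uni by auto
  then show ?case by (auto simp flip: bij_betw_imp_surj_on[OF h])
next
  case (AtLeast i x \<phi>)
  obtain h where h: "bij_betw h (pverts G) (pverts H)"
    and "\<forall>v\<in>pverts G. R (\<sigma>(x := v)) (\<tau>(x := h v))" using move[OF AtLeast.prems(2)] AtLeast.prems(1) by auto
  then have eq: "\<forall>v\<in>pverts G. sat G (\<sigma>(x := v)) \<phi> \<longleftrightarrow> sat H (\<tau>(x := h v)) \<phi>"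
    using AtLeast by auto
  have "{v \<in> pverts H. sat H (\<tau>(x := v)) \<phi>} = h ` {v \<in> pverts G. sat G (\<sigma>(x := v)) \<phi>}"
    using eq by (auto simp flip: bij_betw_imp_surj_on[OF h])
  moreover have "inj_on h {v \<in> pverts G. sat G (\<sigma>(x := v)) \<phi>}"
    using bij_betw_imp_inj_on[OF h] by (rule inj_on_subset) auto
  ultimately show ?case by (simp add: card_image)
qed (use atomic in auto)

section \<open>Types of assignments and formulas that isolate them\<close>

definition C_type :: "nat \<Rightarrow> nat set \<Rightarrow> 'a pair_pre_digraph \<Rightarrow> (nat \<Rightarrow> 'a) \<Rightarrow> fol set" where
  "C_type k S G \<sigma> = {\<phi>. is_C k \<phi> \<and> free_vars \<phi> \<subseteq> S \<and> sat G \<sigma> \<phi>}"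

lemma C_type_eqD:
  "C_type k S G \<sigma> = C_type k S H \<tau> \<Longrightarrow> is_C k \<phi> \<Longrightarrow> free_vars \<phi> \<subseteq> S \<Longrightarrow> sat G \<sigma> \<phi> \<longleftrightarrow> sat H \<tau> \<phi>"
  by (auto simp: C_type_def set_eq_iff)

lemma C_type_mono:
  "C_type k S G \<sigma> = C_type k S H \<tau> \<Longrightarrow> S' \<subseteq> S \<Longrightarrow> C_type k S' G \<sigma> = C_type k S' H \<tau>"
  by (auto simp: C_type_def set_eq_iff)

text \<open>Types are treated as plain sets of formulas, so that one finite set can hold types from
  both graphs although their vertices belong to different HOL types.\<close>

definition complete_type :: "nat \<Rightarrow> nat set \<Rightarrow> fol set \<Rightarrow> bool" where
  "complete_type k S t \<longleftrightarrow> t \<subseteq> {\<phi>. is_C k \<phi> \<and> free_vars \<phi> \<subseteq> S} \<and>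
     (\<forall>\<phi>. is_C k \<phi> \<longrightarrow> free_vars \<phi> \<subseteq> S \<longrightarrow> (Neg \<phi> \<in> t \<longleftrightarrow> \<phi> \<notin> t)) \<and>
     (\<forall>\<phi> \<psi>. Conj \<phi> \<psi> \<in> t \<longleftrightarrow> \<phi> \<in> t \<and> \<psi> \<in> t)"

lemma complete_C_type: "complete_type k S (C_type k S G \<sigma>)"
  by (auto simp: complete_type_def C_type_def)

text \<open>Since negations are available, a type other than \<open>t\<close> lacks some formula of
  \<open>t\<close>; conjoining finitely many of these isolates \<open>t\<close>.\<close>

lemma separating_formula:
  assumes "finite T" "\<forall>t\<in>T. complete_type k S t" "complete_type k S t" "x \<in> S" "x < k"
  shows "\<exists>\<psi>\<in>t. \<forall>t'\<in>T. \<psi> \<in> t' \<longrightarrow> t' = t"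
  using assms(1,2)
proof induction
  case empty
  \<comment> \<open>The empty conjunction has to be some formula of the language.\<close>
  have "Eq x x \<in> t \<or> Neg (Eq x x) \<in> t" using assms(3-5) by (auto simp: complete_type_def)
  then show ?case by blast
next
  case (insert s T)
  obtain \<psi> where \<psi>: "\<psi> \<in> t" "\<forall>t'\<in>T. \<psi> \<in> t' \<longrightarrow> t' = t" using insert by auto
  show ?case
  proof (cases "s = t")
    case False
    have s: "complete_type k S s" using insert by simp
    have "\<exists>\<chi>\<in>t. \<chi> \<notin> s"
    proof (rule ccontr)
      assume sub: "\<not> (\<exists>\<chi>\<in>t. \<chi> \<notin> s)"
      then obtain \<chi> where "\<chi> \<in> s" "\<chi> \<notin> t" using False by blast
      then have "Neg \<chi> \<in> t" "Neg \<chi> \<notin> s"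
        using s assms(3) by (auto simp: complete_type_def subset_iff)
      then show False using sub by blast
    qed
    then obtain \<chi> where \<chi>: "\<chi> \<in> t" "\<chi> \<notin> s" by blast
    have conj: "Conj \<psi> \<chi> \<in> t' \<longleftrightarrow> \<psi> \<in> t' \<and> \<chi> \<in> t'" if "t' \<in> insert s (insert t T)" for t'
      using that insert.prems assms(3) by (auto simp: complete_type_def)
    show ?thesis
    proof (intro bexI[of _ "Conj \<psi> \<chi>"] ballI impI)
      fix t' assume "t' \<in> insert s T" "Conj \<psi> \<chi> \<in> t'"
      then show "t' = t" using conj[of t'] \<chi> \<psi> by auto
    qed (use conj \<chi> \<psi> in auto)
  qed (use \<psi> in auto)
qed

text \<open>Only finitely many types occur in the two graphs, so one formula \<open>\<psi>\<close>
  isolates \<open>t\<close> among them. The number of vertices of type \<open>t\<close> is then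
  visible in the formulas \<open>AtLeast i x \<psi>\<close>, where \<open>x\<close> is no longer
  free.\<close>

lemma C_type_extend:
  assumes fin: "finite (pverts G)" "finite (pverts H)"
    and eq: "C_type k S G \<sigma> = C_type k S H \<tau>" and x: "x < k"
  shows "\<exists>h. bij_betw h (pverts G) (pverts H) \<and>
    (\<forall>v\<in>pverts G. C_type k (insert x S) H (\<tau>(x := h v)) = C_type k (insert x S) G (\<sigma>(x := v)))"
proof (rule bij_betw_of_card_fibres[OF fin])
  fix t
  let ?p = "\<lambda>v. C_type k (insert x S) G (\<sigma>(x := v))"
  let ?q = "\<lambda>v. C_type k (insert x S) H (\<tau>(x := v))"
  define T where "T = ?p ` pverts G \<union> ?q ` pverts H"
  show "card {v \<in> pverts G. ?p v = t} = card {v \<in> pverts H. ?q v = t}"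
  proof (cases "t \<in> T")
    case False
    then have "{v \<in> pverts G. ?p v = t} = {}" "{v \<in> pverts H. ?q v = t} = {}"
      by (auto simp: T_def)
    then show ?thesis by (simp only: card.empty)
  next
    case True
    have "finite T" "\<forall>t\<in>T. complete_type k (insert x S) t"
      using fin by (auto simp: T_def complete_C_type)
    then obtain \<psi> where \<psi>: "\<psi> \<in> t" "\<forall>t'\<in>T. \<psi> \<in> t' \<longrightarrow> t' = t"
      using separating_formula[of T k "insert x S" t x] True x by blast
    have L: "is_C k \<psi>" "free_vars \<psi> \<subseteq> insert x S"
      using \<psi>(1) True by (auto simp: T_def C_type_def)
    have "?p v = t \<longleftrightarrow> sat G (\<sigma>(x := v)) \<psi>" if "v \<in> pverts G" for v
    proof -
      have "?p v \<in> T" using that by (simp add: T_def)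
      then have "?p v = t \<longleftrightarrow> \<psi> \<in> ?p v" using \<psi> by blast
      then show ?thesis using L by (simp add: C_type_def)
    qed
    then have 1: "{v \<in> pverts G. ?p v = t} = {v \<in> pverts G. sat G (\<sigma>(x := v)) \<psi>}" by blast
    have "?q v = t \<longleftrightarrow> sat H (\<tau>(x := v)) \<psi>" if "v \<in> pverts H" for v
    proof -
      have "?q v \<in> T" using that by (simp add: T_def)
      then have "?q v = t \<longleftrightarrow> \<psi> \<in> ?q v" using \<psi> by blast
      then show ?thesis using L by (simp add: C_type_def)
    qed
    then have 2: "{v \<in> pverts H. ?q v = t} = {v \<in> pverts H. sat H (\<tau>(x := v)) \<psi>}" by blast
    have le: "i \<le> card {v \<in> pverts G. ?p v = t} \<longleftrightarrow> i \<le> card {v \<in> pverts H. ?q v = t}" for i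
    proof (cases "i = 0")
      case False
      have "sat G \<sigma> (AtLeast i x \<psi>) \<longleftrightarrow> sat H \<tau> (AtLeast i x \<psi>)"
        by (rule C_type_eqD[OF eq]) (use L x False in auto)
      then show ?thesis unfolding 1 2 by simp
    qed simp
    show ?thesis by (rule antisym[OF iffD1[OF le order_refl] iffD2[OF le order_refl]])
  qed
qed

text \<open>The third variable takes the penultimate vertex, after which the end point is forgotten.
  The variables thus change roles, and the induction has to cover all \<open>i\<close> and
  \<open>j\<close>.\<close>

lemma nwalks_C_type:
  assumes fin: "finite (pverts G)" "finite (pverts H)"
    and "C_type 3 {i, j} G \<sigma> = C_type 3 {i, j} H \<tau>" "i < 3" "j < 3"
  shows "nwalks G l (\<sigma> i) (\<sigma> j) = nwalks H l (\<tau> i) (\<tau> j)"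
  using assms(3-)
proof (induction l arbitrary: i j \<sigma> \<tau>)
  case 0
  then show ?case using C_type_eqD[OF 0(1), of "Eq i j"] by simp
next
  case (Suc l)
  have "\<exists>k<3. k \<noteq> i \<and> k \<noteq> j" for i j :: nat
    by presburger
  then obtain k where k: "k < 3" "k \<noteq> i" "k \<noteq> j" by blast
  obtain h where h: "bij_betw h (pverts G) (pverts H)" and ht: "\<forall>v\<in>pverts G.
      C_type 3 {k, i, j} H (\<tau>(k := h v)) = C_type 3 {k, i, j} G (\<sigma>(k := v))"
    using C_type_extend[OF fin Suc.prems(1) k(1)] by blast
  have step: "((v, \<sigma> j) \<in> parcs G \<longleftrightarrow> (h v, \<tau> j) \<in> parcs H) \<and> nwalks G l (\<sigma> i) v = nwalks H l (\<tau> i) (h v)"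
    if "v \<in> pverts G" for v
  proof
    have t: "C_type 3 {k, i, j} G (\<sigma>(k := v)) = C_type 3 {k, i, j} H (\<tau>(k := h v))"
      using ht that by simp
    show "(v, \<sigma> j) \<in> parcs G \<longleftrightarrow> (h v, \<tau> j) \<in> parcs H"
      using C_type_eqD[OF t, of "Adj k j"] k Suc.prems by simp
    have "C_type 3 {i, k} G (\<sigma>(k := v)) = C_type 3 {i, k} H (\<tau>(k := h v))"
      by (rule C_type_mono[OF t]) auto
    from Suc.IH[OF this] show "nwalks G l (\<sigma> i) v = nwalks H l (\<tau> i) (h v)"
      using k Suc.prems by simp
  qed
  have "nwalks G (Suc l) (\<sigma> i) (\<sigma> j) = (\<Sum>v\<in>pverts G. if (v, \<sigma> j) \<in> parcs G then nwalks G l (\<sigma> i) v else 0)"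
    using fin by (simp add: sum.inter_filter)
  also have "\<dots> = (\<Sum>v\<in>pverts G. if (h v, \<tau> j) \<in> parcs H then nwalks H l (\<tau> i) (h v) else 0)"
    by (rule sum.cong) (use step in auto)
  also have "\<dots> = (\<Sum>v\<in>pverts H. if (v, \<tau> j) \<in> parcs H then nwalks H l (\<tau> i) v else 0)"
    by (rule sum.reindex_bij_betw[OF h])
  also have "\<dots> = nwalks H (Suc l) (\<tau> i) (\<tau> j)"
    using fin by (simp add: sum.inter_filter)
  finally show ?case .
qed

lemma sat_sentence: "free_vars \<phi> = {} \<Longrightarrow> sat G \<sigma> \<phi> \<longleftrightarrow> satisfies G \<phi>"
  unfolding satisfies_def using sat_cong_free_vars[of \<phi> \<sigma> _ G] by auto

lemma C_equivalent_imp_closed_walks: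
  assumes fin: "finite (pverts G)" "finite (pverts H)" and "C_equivalent 3 G H"
  shows "closed_walks G l = closed_walks H l"
proof -
  fix \<sigma> \<tau>
  have "C_type 3 {} G \<sigma> = C_type 3 {} H \<tau>"
    using assms(3) by (auto simp: C_type_def C_equivalent_def C_sentence_def sat_sentence)
  from C_type_extend[OF fin this, of 0]
  obtain h where h: "bij_betw h (pverts G) (pverts H)" and ht: "\<forall>v\<in>pverts G.
      C_type 3 {0} H (\<tau>(0 := h v)) = C_type 3 {0} G (\<sigma>(0 := v))" by auto
  have "nwalks G l v v = nwalks H l (h v) (h v)" if "v \<in> pverts G" for v
    using nwalks_C_type[OF fin, of 0 0 "\<sigma>(0 := v)" "\<tau>(0 := h v)" l] ht that by simp
  then have "closed_walks G l = (\<Sum>v\<in>pverts G. nwalks H l (h v) (h v))"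
    by (simp add: closed_walks_def)
  also have "\<dots> = closed_walks H l"
    unfolding closed_walks_def by (rule sum.reindex_bij_betw[OF h])
  finally show ?thesis .
qed

section \<open>Walks and distances in a distance-regularized graph\<close>

context distance_regularized_graph
begin

section \<open>Walk counts and the distance read off from them\<close>

lemma arcs_sym: "(x, y) \<in> parcs G \<longleftrightarrow> (y, x) \<in> parcs G"
  using arcs_symmetric by blast

lemma nwalks_1:
  assumes "x \<in> pverts G"
  shows "nwalks G 1 x y = (if (x, y) \<in> parcs G then 1 else 0)"
proof -
  have "nwalks G 1 x y = (\<Sum>u | u \<in> pverts G \<and> (u, y) \<in> parcs G. if x = u then 1 else 0)" by simp
  then show ?thesis using pair_finite_verts assms by simp
qed

lemma nwalks_pos_Suc:
  "nwalks G (Suc l) x y > 0 \<longleftrightarrow> (\<exists>z. (z, y) \<in> parcs G \<and> nwalks G l x z > 0)"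
proof -
  have "nwalks G (Suc l) x y = 0 \<longleftrightarrow> (\<forall>z. (z, y) \<in> parcs G \<longrightarrow> nwalks G l x z = 0)"
    using pair_finite_verts by (auto dest: in_arcsD1)
  then show ?thesis by (metis gr0I less_numeral_extra(3))
qed

lemma nwalks_pos_iff:
  assumes "x \<in> pverts G"
  shows "nwalks G l x y > 0 \<longleftrightarrow> (\<exists>p. awalk x p y \<and> length p = l)"
proof (induction l arbitrary: y)
  case 0
  then show ?case using assms by (auto simp: awalk_Nil_iff)
next
  case (Suc l)
  show ?case unfolding nwalks_pos_Suc Suc
  proof (intro iffI; elim exE conjE)
    fix z p assume "(z, y) \<in> parcs G" "awalk x p z" "length p = l"
    then show "\<exists>p. awalk x p y \<and> length p = Suc l"
      using in_arcsD2 by (intro exI[of _ "p @ [(z, y)]"]) (auto simp: awalk_append_iff awalk_simps)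
  next
    fix p assume p: "awalk x p y" "length p = Suc l"
    then obtain q e where q: "p = q @ [e]" by (metis length_Suc_conv_rev)
    then have "awalk x q (fst e)" "e \<in> parcs G" "snd e = y"
      using p by (auto simp: awalk_append_iff awalk_simps)
    then show "\<exists>z. (z, y) \<in> parcs G \<and> (\<exists>p. awalk x p z \<and> length p = l)"
      using p q by (metis add_left_cancel length_append_singleton prod.collapse diff_Suc_1)
  qed
qed

lemma nwalks_add:
  assumes "x \<in> pverts G" "y \<in> pverts G"
  shows "nwalks G (l + m) x y = (\<Sum>z\<in>pverts G. nwalks G l x z * nwalks G m z y)"
  using assms(2)
proof (induction m arbitrary: y)
  case 0
  have "(\<Sum>z\<in>pverts G. nwalks G l x z * nwalks G 0 z y) = (\<Sum>z\<in>pverts G. if z = y then nwalks G l x y else 0)"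
    by (rule sum.cong) auto
  then show ?case using pair_finite_verts 0 by simp
next
  case (Suc m)
  have "nwalks G (l + Suc m) x y =
      (\<Sum>u | u \<in> pverts G \<and> (u, y) \<in> parcs G. \<Sum>z\<in>pverts G. nwalks G l x z * nwalks G m z u)"
    using Suc.IH by simp
  also have "\<dots> = (\<Sum>z\<in>pverts G. nwalks G l x z * nwalks G (Suc m) z y)"
    by (subst sum.swap) (simp add: sum_distrib_left)
  finally show ?case .
qed

lemma nwalks_sym:
  assumes "x \<in> pverts G" "y \<in> pverts G"
  shows "nwalks G l x y = nwalks G l y x"
  using assms(2)
proof (induction l arbitrary: y)
  case (Suc l)
  have "nwalks G 1 y z = (if (z, y) \<in> parcs G then 1 else 0)" for z
    using nwalks_1[OF Suc.prems, of z] arcs_sym[of z y] by (simp del: nwalks.simps)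
  then have "nwalks G (1 + l) y x = (\<Sum>z\<in>pverts G. if (z, y) \<in> parcs G then nwalks G l z x else 0)"
    using nwalks_add[OF Suc.prems assms(1), of 1 l] by (auto intro: sum.cong)
  also have "\<dots> = (\<Sum>z | z \<in> pverts G \<and> (z, y) \<in> parcs G. nwalks G l x z)"
    using pair_finite_verts Suc.IH by (auto simp: sum.inter_filter intro!: sum.cong)
  finally show ?case by simp
qed simp

text \<open>A natural number that shares the recursion of the walk counts; \<open>sphere_eq\<close>
  identifies it with the library's infimum. Connectedness ensures that the \<open>LEAST\<close> is
  attained.\<close>

definition gdist :: "'a \<Rightarrow> 'a \<Rightarrow> nat" where
  "gdist x y = (LEAST l. nwalks G l x y > 0)"

lemma ex_nwalks_pos:
  assumes "x \<in> pverts G" "y \<in> pverts G"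
  shows "\<exists>l. nwalks G l x y > 0"
proof -
  have "x \<rightarrow>\<^sup>*\<^bsub>mk_symmetric (with_proj G)\<^esub> y"
    using connected_graph assms by (auto simp: connected_def strongly_connected_def)
  then have "x \<rightarrow>\<^sup>*\<^bsub>with_proj G\<^esub> y" using reachable_mk_symmetric_eq[OF pair_sym_arcs] by simp
  then show ?thesis using nwalks_pos_iff[OF assms(1)] by (auto simp: reachable_awalk)
qed

lemma nwalks_gdist: "x \<in> pverts G \<Longrightarrow> y \<in> pverts G \<Longrightarrow> nwalks G (gdist x y) x y > 0"
  unfolding gdist_def by (rule LeastI_ex) (rule ex_nwalks_pos)

lemma gdist_le: "nwalks G l x y > 0 \<Longrightarrow> gdist x y \<le> l"
  unfolding gdist_def by (rule Least_le)

lemma gdist_sym: "x \<in> pverts G \<Longrightarrow> y \<in> pverts G \<Longrightarrow> gdist x y = gdist y x"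
  by (simp add: gdist_def nwalks_sym)

lemma gdist_eq_0: "x \<in> pverts G \<Longrightarrow> y \<in> pverts G \<Longrightarrow> gdist x y = 0 \<longleftrightarrow> x = y"
  using nwalks_gdist[of x y] gdist_le[of 0 x y] by (auto split: if_splits)

lemma gdist_adj: "x \<in> pverts G \<Longrightarrow> (z, y) \<in> parcs G \<Longrightarrow> gdist x y \<le> Suc (gdist x z)"
  using nwalks_gdist[of x z] nwalks_pos_Suc[of "gdist x z" x y] in_arcsD1[of z y] by (intro gdist_le) auto

lemma gdist_pred:
  assumes "x \<in> pverts G" "y \<in> pverts G" "gdist x y = Suc j"
  shows "\<exists>z. (z, y) \<in> parcs G \<and> gdist x z = j"
proof -
  obtain z where z: "(z, y) \<in> parcs G" "nwalks G j x z > 0"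
    using nwalks_gdist[OF assms(1,2)] nwalks_pos_Suc[of j x y] assms(3) by auto
  then show ?thesis using gdist_le[OF z(2)] gdist_adj[OF assms(1) z(1)] assms(3) by auto
qed

lemma gdist_eq_1: "x \<in> pverts G \<Longrightarrow> y \<in> pverts G \<Longrightarrow> gdist x y = 1 \<longleftrightarrow> (y, x) \<in> parcs G"
proof
  assume x: "x \<in> pverts G" "y \<in> pverts G" "gdist x y = 1"
  then obtain z where "(z, y) \<in> parcs G" "gdist x z = 0" using gdist_pred[of x y 0] by auto
  then show "(y, x) \<in> parcs G" using gdist_eq_0[OF x(1), of z] in_arcsD1 arcs_sym by metis
next
  assume x: "x \<in> pverts G" "y \<in> pverts G" "(y, x) \<in> parcs G"
  then have "gdist x y \<noteq> 0" using no_loops' gdist_eq_0[of x y] by auto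
  then show "gdist x y = 1" using gdist_adj[of x x y] x gdist_eq_0[of x x] arcs_sym[of x y] by simp
qed

lemma connected_induct [consumes 2, case_names start step]:
  assumes "x \<in> pverts G" "y \<in> pverts G" "P x"
    and step: "\<And>y z. P y \<Longrightarrow> (y, z) \<in> parcs G \<Longrightarrow> P z"
  shows "P y"
  using assms(2)
proof (induction "gdist x y" arbitrary: y)
  case 0
  then show ?case using gdist_eq_0[OF assms(1)] assms(3) by metis
next
  case (Suc j)
  then show ?case using gdist_pred[OF assms(1) Suc.prems] step in_arcsD1 by metis
qed

lemma sphere_eq:
  assumes x: "x \<in> pverts G"
  shows "sphere i x = {y \<in> pverts G. gdist x y = i}"
proof -
  have len: "awalk_cost (\<lambda>_. 1) p = real (length p)" for p :: "('a \<times> 'a) list"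
    by (induction p) auto
  have "\<mu> (\<lambda>_. 1) x y = ereal (real (gdist x y))" if y: "y \<in> pverts G" for y
  proof (rule antisym)
    obtain p where "awalk x p y" "length p = gdist x y"
      using nwalks_gdist[OF x y] nwalks_pos_iff[OF x] by blast
    then show "\<mu> (\<lambda>_. 1) x y \<le> ereal (real (gdist x y))"
      using min_cost_le_walk_cost[of x p y "\<lambda>_. 1"] by (simp add: len)
    have "gdist x y \<le> length p" if "awalk x p y" for p
      using that nwalks_pos_iff[OF x] by (intro gdist_le) blast
    then show "ereal (real (gdist x y)) \<le> \<mu> (\<lambda>_. 1) x y"
      unfolding \<mu>_def by (intro INF_greatest) (simp add: len)
  qed
  then show ?thesis by (auto simp: sphere_def)
qed

text \<open>One function for \<open>c_num\<close>, \<open>a_num\<close> and \<open>b_num\<close>: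
  the cases where \<open>i\<close> is one less than, equal to or one more than
  \<open>gdist x y\<close>.\<close>

definition nbs :: "'a \<Rightarrow> nat \<Rightarrow> 'a \<Rightarrow> nat" where
  "nbs x i y = card {z \<in> pverts G. (z, y) \<in> parcs G \<and> gdist x z = i}"

lemma nbs_sphere:
  assumes "x \<in> pverts G" "y \<in> pverts G"
  shows "card (sphere i x \<inter> sphere 1 y) = nbs x i y"
proof -
  have "sphere i x \<inter> sphere 1 y = {z \<in> pverts G. (z, y) \<in> parcs G \<and> gdist x z = i}"
    using assms gdist_eq_1[of y] by (auto simp: sphere_eq)
  then show ?thesis by (simp add: nbs_def)
qed

lemma nbs_far:
  assumes "x \<in> pverts G" "i > Suc (gdist x y) \<or> gdist x y > Suc i"
  shows "nbs x i y = 0"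
proof -
  have "gdist x z \<noteq> i" if "(z, y) \<in> parcs G" for z
    using gdist_adj[OF assms(1) that] gdist_adj[OF assms(1), of y z] that arcs_sym assms(2) by auto
  then have "{z \<in> pverts G. (z, y) \<in> parcs G \<and> gdist x z = i} = {}" by blast
  then show ?thesis unfolding nbs_def by (simp only: card.empty)
qed

lemma nbs_eq:
  assumes x: "x \<in> pverts G" and yz: "y \<in> pverts G" "z \<in> pverts G" "gdist x y = gdist x z"
  shows "nbs x i y = nbs x i z"
proof -
  define j where "j = gdist x y"
  have "y \<in> sphere j x" "z \<in> sphere j x" using x yz by (auto simp: sphere_eq j_def)
  then have e: "c_num j x y = c_num j x z" "a_num j x y = a_num j x z" "b_num j x y = b_num j x z"
    using distance_regularized[OF x] unfolding distance_regularized_vertex_def by blast+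
  consider "Suc i = j" | "i = j" | "i = Suc j" | "i > Suc j \<or> j > Suc i" by linarith
  then show ?thesis
  proof cases
    case 1
    then show ?thesis using e(1) nbs_sphere[OF x yz(1), of i] nbs_sphere[OF x yz(2), of i] by (auto simp: c_num_def)
  next
    case 2
    then show ?thesis using e(2) nbs_sphere[OF x yz(1), of i] nbs_sphere[OF x yz(2), of i] by (simp add: a_num_def)
  next
    case 3
    then show ?thesis using e(3) nbs_sphere[OF x yz(1), of i] nbs_sphere[OF x yz(2), of i] by (simp add: b_num_def)
  next
    case 4
    then show ?thesis using nbs_far[OF x] yz(3) by (simp add: j_def)
  qed
qed

text \<open>For a vertex \<open>x\<close> the choice is immaterial by \<open>nbs_inter\<close>; the
  value 0 for empty spheres provides \<open>M_empty\<close>.\<close>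

definition inter_num :: "'a \<Rightarrow> nat \<Rightarrow> nat \<Rightarrow> nat" where
  "inter_num x j i = (if \<exists>y\<in>pverts G. gdist x y = j then nbs x i (SOME y. y \<in> pverts G \<and> gdist x y = j) else 0)"

definition valency :: "'a \<Rightarrow> nat" where
  "valency x = card {z \<in> pverts G. (z, x) \<in> parcs G}"

definition sphere_size :: "'a \<Rightarrow> nat \<Rightarrow> nat" where
  "sphere_size x j = card {y \<in> pverts G. gdist x y = j}"

lemma sphere_size_eq_0: "sphere_size x j = 0 \<longleftrightarrow> \<not> (\<exists>y\<in>pverts G. gdist x y = j)"
  using pair_finite_verts by (auto simp: sphere_size_def)

lemma nbs_inter:
  assumes "x \<in> pverts G" "y \<in> pverts G"
  shows "nbs x i y = inter_num x (gdist x y) i"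
proof -
  define w where "w = (SOME z. z \<in> pverts G \<and> gdist x z = gdist x y)"
  have "w \<in> pverts G \<and> gdist x w = gdist x y"
    unfolding w_def by (rule someI[of _ y]) (use assms in simp)
  then have "nbs x i y = nbs x i w" using nbs_eq[OF assms(1,2), of w i] by metis
  moreover have "\<exists>z\<in>pverts G. gdist x z = gdist x y" using assms by blast
  ultimately show ?thesis by (simp add: inter_num_def w_def)
qed

lemma sum_by_gdist:
  fixes f :: "nat \<Rightarrow> nat"
  assumes "finite A" "A \<subseteq> pverts G" "\<And>z. z \<in> A \<Longrightarrow> gdist x z < n"
  shows "(\<Sum>z\<in>A. f (gdist x z)) = (\<Sum>i<n. card {z \<in> A. gdist x z = i} * f i)"
proof -
  have "(\<Sum>i<n. \<Sum>z | z \<in> A \<and> gdist x z = i. f (gdist x z)) = (\<Sum>z\<in>A. f (gdist x z))"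
    using assms by (intro sum.group) auto
  then show ?thesis by simp
qed

lemma sum_nbs:
  fixes f :: "nat \<Rightarrow> nat"
  assumes "\<And>z. z \<in> pverts G \<Longrightarrow> gdist x z < n"
  shows "(\<Sum>z | z \<in> pverts G \<and> (z, y) \<in> parcs G. f (gdist x z)) = (\<Sum>i<n. nbs x i y * f i)"
  using sum_by_gdist[of "{z \<in> pverts G. (z, y) \<in> parcs G}" x n f] assms pair_finite_verts
  by (simp add: nbs_def conj_assoc)

lemma valency_eq_sum_inter:
  assumes "x \<in> pverts G" "y \<in> pverts G" "\<And>z. z \<in> pverts G \<Longrightarrow> gdist x z < n"
  shows "valency y = (\<Sum>i<n. inter_num x (gdist x y) i)"
  using sum_nbs[where y = y and f = "\<lambda>_. 1", OF assms(3)] nbs_inter[OF assms(1,2)] by (simp add: valency_def)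

lemma nwalks_array:
  assumes x: "x \<in> pverts G" and n: "\<And>z. z \<in> pverts G \<Longrightarrow> gdist x z < n"
  shows "y \<in> pverts G \<Longrightarrow> nwalks G l x y = array_walks n (inter_num x) l (gdist x y)"
proof (induction l arbitrary: y)
  case 0
  then show ?case using gdist_eq_0[OF x] by simp
next
  case (Suc l)
  have "nwalks G (Suc l) x y = (\<Sum>z | z \<in> pverts G \<and> (z, y) \<in> parcs G. array_walks n (inter_num x) l (gdist x z))"
    using Suc.IH by simp
  then show ?case using sum_nbs[OF n] nbs_inter[OF x Suc.prems] by simp
qed

lemma local_array:
  assumes x: "x \<in> pverts G" and n: "\<And>z. z \<in> pverts G \<Longrightarrow> gdist x z < n"
    and D: "\<And>z. z \<in> pverts G \<Longrightarrow> valency z = D (gdist x z)"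
  shows "local_array n (inter_num x) (sphere_size x) D (array_walks n (inter_num x))"
proof
  show empty: "inter_num x j i = 0" if "sphere_size x j = 0" for i j
    using that by (simp add: sphere_size_eq_0 inter_num_def)
  have rep: "\<exists>y\<in>pverts G. gdist x y = j" if "sphere_size x j > 0" for j
    using that sphere_size_eq_0[of x j] by simp
  show "inter_num x j i = 0" if "i > Suc j \<or> j > Suc i" for i j
  proof (cases "sphere_size x j = 0")
    case False
    then obtain y where "y \<in> pverts G" "gdist x y = j" using rep by auto
    then show ?thesis using nbs_far[OF x, of y i] nbs_inter[OF x, of y i] that by auto
  qed (rule empty)
  \<comment> \<open>Both sides count the arcs between the spheres of radius \<open>i\<close> and
    \<open>j\<close>.\<close>
  show "sphere_size x i * inter_num x i j = sphere_size x j * inter_num x j i" for i j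
  proof -
    have e: "sphere_size x i * inter_num x i j =
        (\<Sum>y\<in>pverts G. \<Sum>z\<in>pverts G. if (z, y) \<in> parcs G \<and> gdist x y = i \<and> gdist x z = j then 1 else 0)" for i j
    proof -
      have "sphere_size x i * inter_num x i j = (\<Sum>y | y \<in> pverts G \<and> gdist x y = i. nbs x j y)"
        using nbs_inter[OF x] by (simp add: sphere_size_def)
      also have "\<dots> = (\<Sum>y\<in>pverts G. if gdist x y = i then nbs x j y else 0)"
        using pair_finite_verts by (simp add: sum.inter_filter)
      also have "\<dots> = (\<Sum>y\<in>pverts G. \<Sum>z\<in>pverts G. if (z, y) \<in> parcs G \<and> gdist x y = i \<and> gdist x z = j then 1 else 0)"
        by (rule sum.cong) (use pair_finite_verts in \<open>auto simp: nbs_def simp flip: sum.inter_filter\<close>)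
      finally show ?thesis .
    qed
    show ?thesis unfolding e[of i j] e[of j i]
      by (subst sum.swap) (auto intro!: sum.cong simp: arcs_sym)
  qed
  show "(\<Sum>i<n. inter_num x j i) = D j" if "sphere_size x j > 0" for j
    using rep[OF that] valency_eq_sum_inter[OF x _ n] D by metis
  have "{y \<in> pverts G. gdist x y = 0} = {x}" using gdist_eq_0[OF x] x by auto
  then show "sphere_size x 0 = 1" by (simp add: sphere_size_def)
  show "inter_num x (Suc j) j > 0" if pos: "sphere_size x (Suc j) > 0" for j
  proof -
    obtain y where y: "y \<in> pverts G" "gdist x y = Suc j" using rep[OF pos] by blast
    then obtain z where "(z, y) \<in> parcs G" "gdist x z = j" using gdist_pred[OF x] by blast
    then have "nbs x j y > 0"
      using pair_finite_verts in_arcsD1 by (auto simp: nbs_def card_gt_0_iff)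
    then show ?thesis using nbs_inter[OF x y(1)] y by simp
  qed
  show "sphere_size x j = 0" if "j \<ge> n" for j
    using n that by (force simp: sphere_size_eq_0)
qed simp_all

text \<open>In a distance-regular graph these are the intersection numbers p^h_ij with h =
  \<open>gdist x y\<close>.\<close>

definition common :: "'a \<Rightarrow> 'a \<Rightarrow> nat \<Rightarrow> nat \<Rightarrow> nat" where
  "common x y i j = card {z \<in> pverts G. gdist x z = i \<and> gdist y z = j}"

text \<open>Double counting of the arcs \<open>(z, w)\<close> with \<open>d x z = i\<close> and \<open>d y w = j\<close>.\<close>

lemma common_recursion:
  assumes xy: "x \<in> pverts G" "y \<in> pverts G"
    and n: "\<And>z. z \<in> pverts G \<Longrightarrow> gdist x z < n" "\<And>z. z \<in> pverts G \<Longrightarrow> gdist y z < n"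
  shows "(\<Sum>h<n. inter_num x h i * common x y h j) = (\<Sum>h<n. inter_num y h j * common x y i h)"
proof -
  have e: "(\<Sum>h<n. inter_num x h i * common x y h j)
      = (\<Sum>w\<in>pverts G. \<Sum>z\<in>pverts G. if (z, w) \<in> parcs G \<and> gdist x z = i \<and> gdist y w = j then 1 else 0)"
    if x: "x \<in> pverts G" and n: "\<And>z. z \<in> pverts G \<Longrightarrow> gdist x z < n" for x y i j
  proof -
    have "{w \<in> {w \<in> pverts G. gdist y w = j}. gdist x w = h} = {w \<in> pverts G. gdist x w = h \<and> gdist y w = j}" for h
      by auto
    then have "(\<Sum>h<n. inter_num x h i * common x y h j) = (\<Sum>w | w \<in> pverts G \<and> gdist y w = j. inter_num x (gdist x w) i)"
      using sum_by_gdist[of "{w \<in> pverts G. gdist y w = j}" x n "\<lambda>h. inter_num x h i"] n pair_finite_verts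
      by (simp only: common_def mult.commute) simp
    also have "\<dots> = (\<Sum>w | w \<in> pverts G \<and> gdist y w = j. nbs x i w)"
      using nbs_inter[OF x] by simp
    also have "\<dots> = (\<Sum>w\<in>pverts G. if gdist y w = j then nbs x i w else 0)"
      using pair_finite_verts by (simp add: sum.inter_filter)
    also have "\<dots> = (\<Sum>w\<in>pverts G. \<Sum>z\<in>pverts G. if (z, w) \<in> parcs G \<and> gdist x z = i \<and> gdist y w = j then 1 else 0)"
      by (rule sum.cong) (use pair_finite_verts in \<open>auto simp: nbs_def simp flip: sum.inter_filter\<close>)
    finally show ?thesis .
  qed
  have "(\<Sum>h<n. inter_num x h i * common x y h j)
      = (\<Sum>w\<in>pverts G. \<Sum>z\<in>pverts G. if (z, w) \<in> parcs G \<and> gdist x z = i \<and> gdist y w = j then 1 else 0)"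
    by (rule e[OF xy(1) n(1)])
  also have "\<dots> = (\<Sum>z\<in>pverts G. \<Sum>w\<in>pverts G. if (w, z) \<in> parcs G \<and> gdist y w = j \<and> gdist x z = i then 1 else 0)"
    by (subst sum.swap) (auto intro!: sum.cong simp: arcs_sym)
  also have "\<dots> = (\<Sum>h<n. inter_num y h j * common y x h i)"
    by (rule e[OF xy(2) n(2), symmetric])
  also have "\<dots> = (\<Sum>h<n. inter_num y h j * common x y i h)"
    by (simp add: common_def conj_commute)
  finally show ?thesis .
qed

lemma common_empty: "sphere_size x i = 0 \<Longrightarrow> common x y i j = 0"
  using pair_finite_verts by (auto simp: common_def sphere_size_eq_0)

lemma common_0: "x \<in> pverts G \<Longrightarrow> y \<in> pverts G \<Longrightarrow> common x y 0 j = (if gdist x y = j then 1 else 0)"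
proof -
  assume xy: "x \<in> pverts G" "y \<in> pverts G"
  have "{z \<in> pverts G. gdist x z = 0 \<and> gdist y z = j} = (if gdist x y = j then {x} else {})"
    using gdist_eq_0[OF xy(1)] xy gdist_sym[OF xy] by auto
  then show ?thesis by (simp add: common_def)
qed

lemma ex_gdist_bound: "\<exists>n. \<forall>x\<in>pverts G. \<forall>y\<in>pverts G. gdist x y < n"
proof -
  have "finite ((\<lambda>(x, y). gdist x y) ` (pverts G \<times> pverts G))" using pair_finite_verts by simp
  then obtain n where "\<forall>d\<in>(\<lambda>(x, y). gdist x y) ` (pverts G \<times> pverts G). d < n"
    using finite_nat_set_iff_bounded by blast
  then show ?thesis by auto
qed

end

section \<open>Valencies and the spectrum\<close>

context distance_regularized_graph
begin

text \<open>All neighbours of \<open>x\<close> are at distance 1 and hence receive equally many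
  walks from \<open>x\<close>; a closed walk passes through one of them just before its end.\<close>

lemma nwalks_Suc_self:
  assumes "(x, y) \<in> parcs G"
  shows "nwalks G (Suc l) x x = valency x * nwalks G l x y"
proof -
  have V: "x \<in> pverts G" "y \<in> pverts G" using assms wellformed' by auto
  obtain n where n: "\<And>z. z \<in> pverts G \<Longrightarrow> gdist x z < n" using ex_gdist_bound V by blast
  have eq: "nwalks G l x z = nwalks G l x y" if "(z, x) \<in> parcs G" for z
  proof -
    have "z \<in> pverts G" using that in_arcsD1 by blast
    moreover have "gdist x z = gdist x y"
      using gdist_eq_1[OF V] gdist_eq_1[OF V(1) \<open>z \<in> pverts G\<close>] that assms arcs_sym by metis
    ultimately show ?thesis using nwalks_array[OF V(1) n] V(2) by metis
  qed
  show ?thesis by (simp add: eq valency_def)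
qed

lemma valency_pos: "(x, y) \<in> parcs G \<Longrightarrow> valency x > 0"
  using pair_finite_verts arcs_sym[of x y] in_arcsD2[of x y] by (auto simp: valency_def card_gt_0_iff)

text \<open>For an arc \<open>(y, z)\<close> the closed walks at \<open>y\<close> and at
  \<open>z\<close> are multiples of the same number \<open>nwalks G l y z\<close>, and connectedness
  carries the ratio on. Length 0 is excluded: there every vertex has exactly one closed
  walk.\<close>

lemma nwalks_self_proportional:
  assumes "x \<in> pverts G" "y \<in> pverts G"
  shows "valency y * nwalks G (Suc l) x x = valency x * nwalks G (Suc l) y y"
  using assms
proof (induction rule: connected_induct)
  case (step y z)
  have V: "y \<in> pverts G" "z \<in> pverts G" using step.hyps wellformed' by auto
  have "valency z * nwalks G (Suc l) y y = valency y * nwalks G (Suc l) z z"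
    using nwalks_Suc_self[OF step.hyps, of l] nwalks_Suc_self[of z y l] nwalks_sym[OF V, of l]
      step.hyps arcs_sym[of y z] by (simp del: nwalks.simps)
  then have "valency y * (valency z * nwalks G (Suc l) x x) = valency y * (valency x * nwalks G (Suc l) z z)"
    using step.IH by (metis mult.left_commute)
  then show ?case using valency_pos[OF step.hyps] by simp
qed simp

lemma sum_valency: "(\<Sum>x\<in>pverts G. valency x) = closed_walks G 2"
proof -
  have "nwalks G 2 x x = valency x" if "x \<in> pverts G" for x
  proof (cases "\<exists>y. (x, y) \<in> parcs G")
    case True
    then obtain y where y: "(x, y) \<in> parcs G" by blast
    have "nwalks G 1 x y = 1" using nwalks_1[OF that, of y] y by (simp del: nwalks.simps)
    then show ?thesis using nwalks_Suc_self[OF y, of 1] by (simp add: numeral_2_eq_2 del: nwalks.simps)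
  next
    case False
    then have "{z \<in> pverts G. (z, x) \<in> parcs G} = {}" using arcs_sym by blast
    then show ?thesis unfolding numeral_2_eq_2 nwalks.simps valency_def by (simp only: sum.empty card.empty)
  qed
  then show ?thesis by (simp add: closed_walks_def)
qed

text \<open>Summing the proportionality over the second vertex leaves only quantities known from the
  spectrum and the valency of \<open>x\<close>.\<close>

lemma nwalks_self_closed_walks:
  assumes "x \<in> pverts G"
  shows "closed_walks G 2 * nwalks G (Suc l) x x = valency x * closed_walks G (Suc l)"
proof -
  have "closed_walks G 2 * nwalks G (Suc l) x x = (\<Sum>y\<in>pverts G. valency y * nwalks G (Suc l) x x)"
    by (simp add: sum_distrib_right del: nwalks.simps flip: sum_valency)
  also have "\<dots> = (\<Sum>y\<in>pverts G. valency x * nwalks G (Suc l) y y)"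
    using nwalks_self_proportional[OF assms] by (intro sum.cong) auto
  finally show ?thesis by (simp add: closed_walks_def sum_distrib_left del: nwalks.simps)
qed

lemma valency_neighbours:
  assumes "(x, y) \<in> parcs G" "(x, z) \<in> parcs G"
  shows "valency y = valency z"
proof -
  have V: "x \<in> pverts G" "y \<in> pverts G" "z \<in> pverts G" using assms wellformed' by auto
  obtain n where n: "\<And>z. z \<in> pverts G \<Longrightarrow> gdist x z < n" using ex_gdist_bound V by blast
  have "gdist x y = gdist x z"
    using gdist_eq_1[OF V(1,2)] gdist_eq_1[OF V(1,3)] assms arcs_sym by metis
  then show ?thesis using valency_eq_sum_inter[OF V(1) V(2) n] valency_eq_sum_inter[OF V(1) V(3) n] by simp
qed

text \<open>Passing from an arc to the next one swaps the two valencies, so symmetric functions of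
  them stay constant.\<close>

lemma valencies:
  assumes "parcs G \<noteq> {}"
  obtains u v where "(u, v) \<in> parcs G"
    "\<And>x y. (x, y) \<in> parcs G \<Longrightarrow> valency x + valency y = valency u + valency v \<and> valency x * valency y = valency u * valency v"
proof -
  obtain u v where uv: "(u, v) \<in> parcs G" using assms by auto
  have "\<forall>z. (y, z) \<in> parcs G \<longrightarrow> valency y + valency z = valency u + valency v \<and> valency y * valency z = valency u * valency v"
    if "y \<in> pverts G" for y
    using in_arcsD1[OF uv] that
  proof (induction rule: connected_induct)
    case start
    show ?case using valency_neighbours[OF uv] by metis
  next
    case (step y z)
    have "(z, y) \<in> parcs G" using step arcs_sym by blast
    then have "valency w = valency y" if "(z, w) \<in> parcs G" for w using valency_neighbours that by metis
    then show ?case using step by (metis add.commute mult.commute)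
  qed
  then show ?thesis using that[OF uv] in_arcsD1 by blast
qed

text \<open>Supplies the degrees \<open>D\<close> of a local array and, in the game, the valency of
  a newly pebbled vertex.\<close>

lemma valency_parity:
  assumes S: "\<And>x y. (x, y) \<in> parcs G \<Longrightarrow> valency x + valency y = S"
    and x: "x \<in> pverts G" and y: "y \<in> pverts G"
  shows "valency y = (if even (gdist x y) then valency x else S - valency x)"
  using y
proof (induction "gdist x y" arbitrary: y)
  case 0
  then show ?case using gdist_eq_0[OF x] by force
next
  case (Suc j)
  obtain z where z: "(z, y) \<in> parcs G" "gdist x z = j" using gdist_pred[OF x Suc.prems] Suc.hyps(2) by metis
  have "valency z = (if even j then valency x else S - valency x)"
    using Suc.hyps(1)[of z] z in_arcsD1 by metis
  \<comment> \<open>Needed for odd \<open>j\<close>, where the truncated difference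
    \<open>S - (S - valency x)\<close> has to be \<open>valency x\<close>.\<close>
  moreover have "valency x \<le> S"
  proof (cases "j = 0")
    case True
    then show ?thesis using calculation S[OF z(1)] by simp
  next
    case False
    then obtain i where "gdist x z = Suc i" using z(2) by (cases j) auto
    have "\<exists>w. (x, w) \<in> parcs G"
    proof -
      have "x \<noteq> z" using \<open>gdist x z = Suc i\<close> gdist_eq_0[OF x x] by auto
      have "nwalks G (gdist z x) z x > 0" using nwalks_gdist x z in_arcsD1 by blast
      moreover have "gdist z x = Suc i" using gdist_sym x z in_arcsD1 \<open>gdist x z = Suc i\<close> by metis
      ultimately show ?thesis using nwalks_pos_Suc[of i z x] arcs_sym by auto
    qed
    then show ?thesis using S by (metis le_add1)
  qed
  moreover have "even (gdist x y) \<longleftrightarrow> odd j" using Suc.hyps(2) by presburger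
  ultimately show ?case using S[OF z(1)] by (cases "even j") auto
qed

text \<open>The all-ones vector is an eigenvector of the squared adjacency matrix: one
  multiplication gives the valencies, the next sums them over the neighbours of \<open>z\<close>,
  and this is \<open>valency z * valency w = P\<close> for any neighbour \<open>w\<close>.\<close>

lemma sum_nwalks_even:
  assumes P: "\<And>x y. (x, y) \<in> parcs G \<Longrightarrow> valency x * valency y = P" and nonempty: "parcs G \<noteq> {}"
    and x: "x \<in> pverts G"
  shows "(\<Sum>y\<in>pverts G. nwalks G (2 * l) x y) = P ^ l"
proof (induction l)
  case 0
  then show ?case using x pair_finite_verts by simp
next
  case (Suc l)
  \<comment> \<open>Self-adjointness: the last arc moves from the walk to the weight
    \<open>f\<close>.\<close>
  have step: "(\<Sum>y\<in>pverts G. f y * nwalks G (Suc l) x y) =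
      (\<Sum>z\<in>pverts G. (\<Sum>y | y \<in> pverts G \<and> (y, z) \<in> parcs G. f y) * nwalks G l x z)" for f l
  proof -
    have "(\<Sum>y\<in>pverts G. f y * nwalks G (Suc l) x y) =
        (\<Sum>y\<in>pverts G. \<Sum>z\<in>pverts G. if (y, z) \<in> parcs G then f y * nwalks G l x z else 0)"
      by (rule sum.cong) (use pair_finite_verts arcs_sym in \<open>auto simp: sum_distrib_left sum.inter_filter if_distrib cong: if_cong\<close>)
    also have "\<dots> = (\<Sum>z\<in>pverts G. \<Sum>y\<in>pverts G. if (y, z) \<in> parcs G then f y * nwalks G l x z else 0)"
      by (rule sum.swap)
    also have "\<dots> = (\<Sum>z\<in>pverts G. (\<Sum>y | y \<in> pverts G \<and> (y, z) \<in> parcs G. f y) * nwalks G l x z)"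
      by (rule sum.cong) (use pair_finite_verts in \<open>simp_all add: sum_distrib_right flip: sum.inter_filter\<close>)
    finally show ?thesis .
  qed
  have P': "(\<Sum>y | y \<in> pverts G \<and> (y, z) \<in> parcs G. valency y) = P" if z: "z \<in> pverts G" for z
  proof -
    obtain u v where uv: "(u, v) \<in> parcs G" using nonempty by auto
    have "\<exists>w. (z, w) \<in> parcs G"
    proof (cases "u = z")
      case False
      then obtain i where "gdist u z = Suc i" using gdist_eq_0[OF in_arcsD1[OF uv] z] by (cases "gdist u z") auto
      then show ?thesis using gdist_pred[OF in_arcsD1[OF uv] z] arcs_sym by blast
    qed (use uv in auto)
    then obtain w where w: "(z, w) \<in> parcs G" by blast
    have "(\<Sum>y | y \<in> pverts G \<and> (y, z) \<in> parcs G. valency y) = (\<Sum>y | y \<in> pverts G \<and> (y, z) \<in> parcs G. valency w)"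
      by (rule sum.cong) (use valency_neighbours[OF _ w] arcs_sym in auto)
    also have "\<dots> = valency z * valency w" by (simp add: valency_def)
    finally show ?thesis using P[OF w] by simp
  qed
  have "(\<Sum>y\<in>pverts G. nwalks G (2 * Suc l) x y) = (\<Sum>y\<in>pverts G. 1 * nwalks G (Suc (Suc (2 * l))) x y)"
    by simp
  also have "\<dots> = (\<Sum>z\<in>pverts G. valency z * nwalks G (Suc (2 * l)) x z)"
    unfolding step by (simp add: valency_def del: nwalks.simps)
  also have "\<dots> = (\<Sum>z\<in>pverts G. P * nwalks G (2 * l) x z)"
    unfolding step using P' by (simp del: nwalks.simps)
  finally show ?case using Suc by (simp add: sum_distrib_left[symmetric] del: nwalks.simps)
qed

text \<open>\<open>P\<close> is the square of the spectral radius, as this bound and \<open>closed_walks_ge\<close> show.\<close>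

lemma closed_walks_le:
  assumes "\<And>x y. (x, y) \<in> parcs G \<Longrightarrow> valency x * valency y = P" "parcs G \<noteq> {}"
  shows "closed_walks G (2 * l) \<le> card (pverts G) * P ^ l"
proof -
  have "nwalks G (2 * l) x x \<le> P ^ l" if "x \<in> pverts G" for x
    using sum_nwalks_even[OF assms that, of l] member_le_sum[of x "pverts G" "nwalks G (2 * l) x"] that pair_finite_verts
    by auto
  then show ?thesis unfolding closed_walks_def by (intro sum_bounded_above[where 'a = nat, simplified])
qed

text \<open>Cauchy-Schwarz over the end points of the walks of length \<open>2 * l\<close> from
  \<open>x\<close>: their total is \<open>P ^ l\<close>, and the sum of squares counts closed walks
  of length \<open>4 * l\<close> at \<open>x\<close>. Summing over \<open>x\<close> lets the number
  of vertices cancel.\<close>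

lemma closed_walks_ge:
  assumes "\<And>x y. (x, y) \<in> parcs G \<Longrightarrow> valency x * valency y = P" "parcs G \<noteq> {}"
  shows "P ^ (2 * l) \<le> closed_walks G (4 * l)"
proof -
  have "P ^ (2 * l) \<le> card (pverts G) * nwalks G (4 * l) x x" if x: "x \<in> pverts G" for x
  proof -
    have "P ^ (2 * l) = (\<Sum>y\<in>pverts G. nwalks G (2 * l) x y)\<^sup>2"
      using sum_nwalks_even[OF assms x, of l] by (simp add: power_mult[symmetric] mult.commute)
    also have "\<dots> \<le> card (pverts G) * (\<Sum>y\<in>pverts G. (nwalks G (2 * l) x y)\<^sup>2)"
    proof -
      have "(\<Sum>y\<in>pverts G. real (nwalks G (2 * l) x y))\<^sup>2 \<le> (\<Sum>y\<in>pverts G. (real (nwalks G (2 * l) x y))\<^sup>2) * card (pverts G)"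
        by (rule sum_squared_le_sum_of_squares)
      then show ?thesis by (simp add: mult.commute flip: of_nat_sum of_nat_power of_nat_mult)
    qed
    also have "(\<Sum>y\<in>pverts G. (nwalks G (2 * l) x y)\<^sup>2) = nwalks G (2 * l + 2 * l) x x"
      unfolding nwalks_add[OF x x]
      by (rule sum.cong) (auto simp: power2_eq_square nwalks_sym[OF x])
    finally show ?thesis by (simp add: mult_2[symmetric])
  qed
  then have "(\<Sum>x\<in>pverts G. P ^ (2 * l)) \<le> (\<Sum>x\<in>pverts G. card (pverts G) * nwalks G (4 * l) x x)"
    by (intro sum_mono) auto
  then have "card (pverts G) * P ^ (2 * l) \<le> card (pverts G) * closed_walks G (4 * l)"
    by (simp add: closed_walks_def sum_distrib_left)
  moreover have "card (pverts G) > 0"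
    using assms(2) in_arcsD1 pair_finite_verts by (auto simp: card_gt_0_iff)
  ultimately show ?thesis by simp
qed

text \<open>The valencies of the tails are summed over all arcs. Each head contributes
  \<open>P\<close>; by symmetry the valencies of the heads have the same total; and the two ends of
  one arc contribute \<open>S\<close>.\<close>

lemma closed_walks_2_sum:
  assumes P: "\<And>x y. (x, y) \<in> parcs G \<Longrightarrow> valency x * valency y = P" and ne: "parcs G \<noteq> {}"
    and S: "\<And>x y. (x, y) \<in> parcs G \<Longrightarrow> valency x + valency y = S"
  shows "closed_walks G 2 * S = 2 * card (pverts G) * P"
proof -
  define T where "T = (\<Sum>x\<in>pverts G. \<Sum>y\<in>pverts G. if (y, x) \<in> parcs G then valency y else 0)"
  have sq: "(\<Sum>y\<in>pverts G. if (y, x) \<in> parcs G then valency y else 0) = P" if x: "x \<in> pverts G" for x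
  proof -
    \<comment> \<open>The walks of length 2 from \<open>x\<close> are grouped by their middle vertex
      \<open>y\<close>, which has \<open>valency y\<close> continuations.\<close>
    have "P = (\<Sum>z\<in>pverts G. nwalks G 2 x z)" using sum_nwalks_even[OF P ne x, of 1] by simp
    also have "\<dots> = (\<Sum>z\<in>pverts G. \<Sum>y\<in>pverts G. if (y, z) \<in> parcs G then nwalks G 1 x y else 0)"
      unfolding numeral_2_eq_2 One_nat_def[symmetric] nwalks.simps(2)[of _ 1]
      using pair_finite_verts by (simp only: sum.inter_filter)
    also have "\<dots> = (\<Sum>y\<in>pverts G. \<Sum>z\<in>pverts G. if (y, z) \<in> parcs G then nwalks G 1 x y else 0)"
      by (rule sum.swap)
    also have "\<dots> = (\<Sum>y\<in>pverts G. if (y, x) \<in> parcs G then valency y else 0)"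
    proof (rule sum.cong)
      fix y
      have "{z \<in> pverts G. (y, z) \<in> parcs G} = {z \<in> pverts G. (z, y) \<in> parcs G}" using arcs_sym by blast
      then have "(\<Sum>z\<in>pverts G. if (y, z) \<in> parcs G then nwalks G 1 x y else 0) = valency y * nwalks G 1 x y"
        using pair_finite_verts by (simp add: valency_def del: nwalks.simps flip: sum.inter_filter)
      then show "(\<Sum>z\<in>pverts G. if (y, z) \<in> parcs G then nwalks G 1 x y else 0) = (if (y, x) \<in> parcs G then valency y else 0)"
        using nwalks_1[OF x, of y] arcs_sym[of x y] by (simp del: nwalks.simps)
    qed simp
    finally show ?thesis by simp
  qed
  then have T1: "T = card (pverts G) * P" by (simp add: T_def)
  have T2: "T = (\<Sum>x\<in>pverts G. \<Sum>y\<in>pverts G. if (y, x) \<in> parcs G then valency x else 0)"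
    unfolding T_def by (subst sum.swap) (auto intro!: sum.cong simp: arcs_sym)
  have "T + T = (\<Sum>x\<in>pverts G. \<Sum>y\<in>pverts G.
      (if (y, x) \<in> parcs G then valency y else 0) + (if (y, x) \<in> parcs G then valency x else 0))"
    by (subst (2) T2) (simp only: T_def sum.distrib)
  also have "\<dots> = (\<Sum>x\<in>pverts G. \<Sum>y\<in>pverts G. if (y, x) \<in> parcs G then S else 0)"
    using S by (intro sum.cong) auto
  also have "\<dots> = (\<Sum>x\<in>pverts G. valency x * S)"
    using pair_finite_verts by (simp add: valency_def flip: sum.inter_filter)
  also have "\<dots> = closed_walks G 2 * S" by (simp add: sum_distrib_right flip: sum_valency)
  finally show ?thesis using T1 by simp
qed

end

lemma (in distance_regularized_graph) closed_walks_2_eq_0: "closed_walks G 2 = 0 \<longleftrightarrow> parcs G = {}"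
proof
  assume "closed_walks G 2 = 0"
  then have "valency x = 0" if "x \<in> pverts G" for x
    using that pair_finite_verts by (simp flip: sum_valency)
  then show "parcs G = {}" using valency_pos in_arcsD1 by fastforce
next
  assume "parcs G = {}"
  then show "closed_walks G 2 = 0" by (simp add: valency_def flip: sum_valency)
qed

text \<open>Both bounds at length \<open>4 * l\<close> bound the powers of
  \<open>(P / Q)\<^sup>2\<close> by the constant number of vertices, which a ratio above 1 would
  outgrow. Exchanging the graphs gives the other inequality.\<close>

lemma valency_product_le:
  assumes G: "distance_regularized_graph G" and H: "distance_regularized_graph H"
    and cw: "\<And>l. closed_walks G l = closed_walks H l"
    and P: "\<And>x y. (x, y) \<in> parcs G \<Longrightarrow>
      distance_regularized_graph.valency G x * distance_regularized_graph.valency G y = P" "parcs G \<noteq> {}"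
    and Q: "\<And>x y. (x, y) \<in> parcs H \<Longrightarrow>
      distance_regularized_graph.valency H x * distance_regularized_graph.valency H y = Q" "parcs H \<noteq> {}"
  shows "P \<le> Q"
proof (rule ccontr)
  assume PQ: "\<not> P \<le> Q"
  define n where "n = card (pverts H)"
  have le: "P ^ (2 * l) \<le> n * Q ^ (2 * l)" for l
  proof -
    have "P ^ (2 * l) \<le> closed_walks H (4 * l)"
      using distance_regularized_graph.closed_walks_ge[OF G P] cw by simp
    also have "4 * l = 2 * (2 * l)" by simp
    also have "closed_walks H (2 * (2 * l)) \<le> n * Q ^ (2 * l)"
      unfolding n_def by (rule distance_regularized_graph.closed_walks_le[OF H Q])
    finally show ?thesis .
  qed
  have "Q > 0"
  proof (rule ccontr)
    assume "\<not> Q > 0"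
    then show False using le[of 1] PQ by simp
  qed
  then have "1 < (real P / real Q)\<^sup>2" using PQ by (simp add: one_less_power)
  then obtain l where "real n < ((real P / real Q)\<^sup>2) ^ l" using real_arch_pow by blast
  then have "real n * real Q ^ (2 * l) < real P ^ (2 * l)"
    using \<open>Q > 0\<close> by (simp add: power_divide pos_less_divide_eq flip: power_mult)
  then have "n * Q ^ (2 * l) < P ^ (2 * l)"
    by (simp flip: of_nat_power of_nat_mult)
  then show False using le[of l] by simp
qed

lemma eq_or_eq_of_sum_prod_eq:
  fixes a b c d :: "'a :: idom"
  assumes "a + b = c + d" "a * b = c * d"
  shows "a = c \<or> a = d"
proof -
  have "(a - c) * (a - d) = a * a - a * (c + d) + c * d" by (simp add: algebra_simps)
  also have "\<dots> = 0" by (simp add: algebra_simps flip: assms)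
  finally show ?thesis by simp
qed

section \<open>Comparison of two graphs\<close>

locale closed_walk_equivalent = X: distance_regularized_graph G + Y: distance_regularized_graph H for G H +
  assumes closed_walks_eq: "closed_walks G l = closed_walks H l"
begin

lemma card_verts: "card (pverts G) = card (pverts H)"
  using closed_walks_eq[of 0] by (simp add: closed_walks_def)

lemma arcs_empty_iff: "parcs G = {} \<longleftrightarrow> parcs H = {}"
  using X.closed_walks_2_eq_0 Y.closed_walks_2_eq_0 closed_walks_eq[of 2] by simp

text \<open>Sum and product fix the two valencies only as an unordered pair, so only some pair of
  vertices is claimed to match. Without arcs the conditions on \<open>S\<close> are vacuous and 0 is
  chosen.\<close>

lemma valencies_agree:
  "\<exists>S. (\<forall>x y. (x, y) \<in> parcs G \<longrightarrow> X.valency x + X.valency y = S) \<and>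
    (\<forall>x y. (x, y) \<in> parcs H \<longrightarrow> Y.valency x + Y.valency y = S) \<and>
    (\<exists>x\<in>pverts G. \<exists>y\<in>pverts H. X.valency x = Y.valency y)"
proof (cases "parcs G = {}")
  case True
  have "pverts G \<noteq> {}" "pverts H \<noteq> {}"
    using X.connected_graph Y.connected_graph by (auto simp: connected_def strongly_connected_def)
  then obtain x y where "x \<in> pverts G" "y \<in> pverts H" by blast
  moreover have "X.valency x = 0" "Y.valency y = 0"
    using True arcs_empty_iff by (simp_all add: X.valency_def Y.valency_def)
  ultimately have "\<exists>x\<in>pverts G. \<exists>y\<in>pverts H. X.valency x = Y.valency y" by metis
  then show ?thesis by (intro exI[of _ 0]) (use True arcs_empty_iff in auto)
next
  case False
  then have ne: "parcs G \<noteq> {}" "parcs H \<noteq> {}" using arcs_empty_iff by auto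
  obtain u v where uv: "(u, v) \<in> parcs G" and
    SG: "\<And>x y. (x, y) \<in> parcs G \<Longrightarrow> X.valency x + X.valency y = X.valency u + X.valency v \<and>
      X.valency x * X.valency y = X.valency u * X.valency v"
    by (rule X.valencies[OF ne(1)]) blast
  obtain w z where wz: "(w, z) \<in> parcs H" and
    SH: "\<And>x y. (x, y) \<in> parcs H \<Longrightarrow> Y.valency x + Y.valency y = Y.valency w + Y.valency z \<and>
      Y.valency x * Y.valency y = Y.valency w * Y.valency z"
    by (rule Y.valencies[OF ne(2)]) blast
  have P: "X.valency u * X.valency v = Y.valency w * Y.valency z"
  proof (rule antisym)
    show "X.valency u * X.valency v \<le> Y.valency w * Y.valency z"
      by (rule valency_product_le[OF X.distance_regularized_graph_axioms Y.distance_regularized_graph_axioms])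
        (use closed_walks_eq SG SH ne in auto)
    show "Y.valency w * Y.valency z \<le> X.valency u * X.valency v"
      by (rule valency_product_le[OF Y.distance_regularized_graph_axioms X.distance_regularized_graph_axioms])
        (use closed_walks_eq SG SH ne in auto)
  qed
  have "closed_walks G 2 * (X.valency u + X.valency v) = 2 * card (pverts G) * (X.valency u * X.valency v)"
    by (rule X.closed_walks_2_sum) (use SG ne in auto)
  moreover have "closed_walks H 2 * (Y.valency w + Y.valency z) = 2 * card (pverts H) * (Y.valency w * Y.valency z)"
    by (rule Y.closed_walks_2_sum) (use SH ne in auto)
  ultimately have "closed_walks H 2 * (X.valency u + X.valency v) = closed_walks H 2 * (Y.valency w + Y.valency z)"
    using closed_walks_eq[of 2] card_verts P by metis
  then have S: "X.valency u + X.valency v = Y.valency w + Y.valency z"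
    using Y.closed_walks_2_eq_0 ne by simp
  have "X.valency u = Y.valency w \<or> X.valency u = Y.valency z"
    using eq_or_eq_of_sum_prod_eq[of "int (X.valency u)" "int (X.valency v)" "int (Y.valency w)" "int (Y.valency z)"] S P
    by (simp flip: of_nat_add of_nat_mult)
  then have "\<exists>x\<in>pverts G. \<exists>y\<in>pverts H. X.valency x = Y.valency y"
    using X.in_arcsD1[OF uv] Y.in_arcsD1[OF wz] Y.in_arcsD2[OF wz] by blast
  then show ?thesis using SG SH S by (intro exI[of _ "X.valency u + X.valency v"]) auto
qed

lemma nwalks_self_eq:
  assumes "x \<in> pverts G" "x' \<in> pverts H" "X.valency x = Y.valency x'"
  shows "nwalks G l x x = nwalks H l x' x'"
proof (cases l)
  case (Suc m)
  show ?thesis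
  \<comment> \<open>Without arcs the factor \<open>closed_walks G 2\<close> is 0 and cannot be
    cancelled.\<close>
  proof (cases "parcs G = {}")
    case True
    then show ?thesis using arcs_empty_iff Suc by simp
  next
    case False
    have "closed_walks G 2 * nwalks G (Suc m) x x = closed_walks G 2 * nwalks H (Suc m) x' x'"
      using X.nwalks_self_closed_walks[OF assms(1), of m] Y.nwalks_self_closed_walks[OF assms(2), of m]
        closed_walks_eq assms(3) by metis
    then show ?thesis using False X.closed_walks_2_eq_0 Suc by (simp del: nwalks.simps)
  qed
qed simp

lemma ex_common_bound:
  "\<exists>n. (\<forall>x\<in>pverts G. \<forall>y\<in>pverts G. X.gdist x y < n) \<and> (\<forall>x\<in>pverts H. \<forall>y\<in>pverts H. Y.gdist x y < n)"
proof -
  obtain n m where "\<forall>x\<in>pverts G. \<forall>y\<in>pverts G. X.gdist x y < n" "\<forall>x\<in>pverts H. \<forall>y\<in>pverts H. Y.gdist x y < m"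
    using X.ex_gdist_bound Y.ex_gdist_bound by blast
  then show ?thesis by (intro exI[of _ "max n m"]) (auto simp: less_max_iff_disj)
qed

text \<open>
  The invariant of Duplicator's strategy in the bijective pebble game with three pebbles.
\<close>

definition matching :: "(nat \<Rightarrow> 'a) \<Rightarrow> (nat \<Rightarrow> 'b) \<Rightarrow> bool" where
  "matching \<sigma> \<tau> \<longleftrightarrow>
     (\<forall>i<3. \<sigma> i \<in> pverts G \<and> \<tau> i \<in> pverts H \<and> X.valency (\<sigma> i) = Y.valency (\<tau> i)) \<and>
     (\<forall>i<3. \<forall>j<3. X.gdist (\<sigma> i) (\<sigma> j) = Y.gdist (\<tau> i) (\<tau> j))"

context
  fixes S n
  assumes S: "\<And>x y. (x, y) \<in> parcs G \<Longrightarrow> X.valency x + X.valency y = S"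
    "\<And>x y. (x, y) \<in> parcs H \<Longrightarrow> Y.valency x + Y.valency y = S"
  assumes n: "\<And>x y. x \<in> pverts G \<Longrightarrow> y \<in> pverts G \<Longrightarrow> X.gdist x y < n"
    "\<And>x y. x \<in> pverts H \<Longrightarrow> y \<in> pverts H \<Longrightarrow> Y.gdist x y < n"
begin

lemma local_array_pair:
  assumes "x \<in> pverts G" "x' \<in> pverts H" "X.valency x = Y.valency x'"
  shows "local_array_pair n (X.inter_num x) (X.sphere_size x) (\<lambda>j. if even j then X.valency x else S - X.valency x)
    (array_walks n (X.inter_num x)) (Y.inter_num x') (Y.sphere_size x') (array_walks n (Y.inter_num x'))"
proof (intro local_array_pair.intro local_array_pair_axioms.intro)
  show "local_array n (X.inter_num x) (X.sphere_size x) (\<lambda>j. if even j then X.valency x else S - X.valency x)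
      (array_walks n (X.inter_num x))"
    by (rule X.local_array[OF assms(1) n(1)[OF assms(1)] X.valency_parity[OF S(1) assms(1)]])
  show "local_array n (Y.inter_num x') (Y.sphere_size x') (\<lambda>j. if even j then X.valency x else S - X.valency x)
      (array_walks n (Y.inter_num x'))"
    unfolding assms(3)
    by (rule Y.local_array[OF assms(2) n(2)[OF assms(2)] Y.valency_parity[OF S(2) assms(2)]])
  show "array_walks n (X.inter_num x) l 0 = array_walks n (Y.inter_num x') l 0" for l
    using X.nwalks_array[OF assms(1) n(1)[OF assms(1)] assms(1), of l]
      Y.nwalks_array[OF assms(2) n(2)[OF assms(2)] assms(2), of l]
      nwalks_self_eq[OF assms] X.gdist_eq_0[OF assms(1,1)] Y.gdist_eq_0[OF assms(2,2)] by metis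
qed

text \<open>In the recursion for \<open>m = i - 1\<close>, one side involves only level
  \<open>m\<close>, and on the other side only level \<open>i\<close> is new. Its coefficient is c_i
  of the array of \<open>x\<close>, which is positive unless the sphere is empty.\<close>

lemma common_eq:
  assumes x: "x \<in> pverts G" "x' \<in> pverts H" "X.valency x = Y.valency x'"
    and y: "y \<in> pverts G" "y' \<in> pverts H" "X.valency y = Y.valency y'"
    and d: "X.gdist x y = Y.gdist x' y'"
  shows "X.common x y i j = Y.common x' y' i j"
proof (induction i arbitrary: j rule: less_induct)
  case (less i)
  interpret x: local_array_pair n "X.inter_num x" "X.sphere_size x" "\<lambda>j. if even j then X.valency x else S - X.valency x"
    "array_walks n (X.inter_num x)" "Y.inter_num x'" "Y.sphere_size x'" "array_walks n (Y.inter_num x')"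
    by (rule local_array_pair[OF x])
  interpret y: local_array_pair n "X.inter_num y" "X.sphere_size y" "\<lambda>j. if even j then X.valency y else S - X.valency y"
    "array_walks n (X.inter_num y)" "Y.inter_num y'" "Y.sphere_size y'" "array_walks n (Y.inter_num y')"
    by (rule local_array_pair[OF y])
  show ?case
  proof (cases i)
    case 0
    then show ?thesis using X.common_0[OF x(1) y(1)] Y.common_0[OF x(2) y(2)] d by simp
  next
    case (Suc m)
    show ?thesis
    proof (cases "X.sphere_size x i = 0")
      case True
      then have "Y.sphere_size x' i = 0" using x.K_eq by metis
      then show ?thesis using True X.common_empty Y.common_empty by metis
    next
      case False
      then have pos: "X.inter_num x i m > 0" using x.X.M_pred[of m] Suc by simp
      have "i < n" using False x.X.K_bound[of i] by (cases "i < n") auto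
      have "(\<Sum>h<n. X.inter_num x h m * X.common x y h j) = (\<Sum>h<n. X.inter_num y h j * X.common x y m h)"
        by (rule X.common_recursion[OF x(1) y(1) n(1)[OF x(1)] n(1)[OF y(1)]])
      also have "\<dots> = (\<Sum>h<n. Y.inter_num y' h j * Y.common x' y' m h)"
        using less.IH[of m] Suc y.M_eq by simp
      also have "\<dots> = (\<Sum>h<n. Y.inter_num x' h m * Y.common x' y' h j)"
        by (rule Y.common_recursion[OF x(2) y(2) n(2)[OF x(2)] n(2)[OF y(2)], symmetric])
      finally have "X.inter_num x i m * X.common x y i j = Y.inter_num x' i m * Y.common x' y' i j"
      proof (rule sum_cancel[OF \<open>i < n\<close>])
        fix h assume "h \<noteq> i"
        then consider "h < i" | "h > Suc m" using Suc by linarith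
        then show "X.inter_num x h m * X.common x y h j = Y.inter_num x' h m * Y.common x' y' h j"
        proof cases
          case 1
          then show ?thesis using less.IH x.M_eq by simp
        next
          case 2
          then show ?thesis using x.X.tridiagonal[of h m] x.Y.tridiagonal[of h m] by simp
        qed
      qed
      then show ?thesis using pos x.M_eq by simp
    qed
  qed
qed

text \<open>While pebble \<open>x\<close> is lifted, only the other two constrain the bijection, so
  it suffices that vertices are equally distributed over the pairs of distances from them.\<close>

lemma matching_move:
  assumes m: "matching \<sigma> \<tau>" and x: "x < 3"
  shows "\<exists>h. bij_betw h (pverts G) (pverts H) \<and> (\<forall>v\<in>pverts G. matching (\<sigma>(x := v)) (\<tau>(x := h v)))"
proof -
  have "\<exists>y<3. \<exists>z<3. y \<noteq> x \<and> z \<noteq> x \<and> (\<forall>i<3. i = x \<or> i = y \<or> i = z)"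
    using x by presburger
  then obtain y z where yz: "y < 3" "z < 3" "y \<noteq> x" "z \<noteq> x" "\<And>i. i < 3 \<Longrightarrow> i = x \<or> i = y \<or> i = z"
    by blast
  have V: "\<sigma> y \<in> pverts G" "\<tau> y \<in> pverts H" "X.valency (\<sigma> y) = Y.valency (\<tau> y)"
    "\<sigma> z \<in> pverts G" "\<tau> z \<in> pverts H" "X.valency (\<sigma> z) = Y.valency (\<tau> z)"
    "X.gdist (\<sigma> y) (\<sigma> z) = Y.gdist (\<tau> y) (\<tau> z)" "X.gdist (\<sigma> z) (\<sigma> y) = Y.gdist (\<tau> z) (\<tau> y)"
    using m yz(1,2) by (auto simp: matching_def)
  let ?p = "\<lambda>v. (X.gdist (\<sigma> y) v, X.gdist (\<sigma> z) v)"
  let ?q = "\<lambda>v. (Y.gdist (\<tau> y) v, Y.gdist (\<tau> z) v)"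
  have "card {v \<in> pverts G. ?p v = t} = card {v \<in> pverts H. ?q v = t}" for t
  proof (cases t)
    case (Pair i j)
    then show ?thesis using common_eq[OF V(1-7), of i j] by (simp add: X.common_def Y.common_def)
  qed
  from bij_betw_of_card_fibres[OF X.pair_finite_verts Y.pair_finite_verts this]
  obtain h where h: "bij_betw h (pverts G) (pverts H)" and hq: "\<And>v. v \<in> pverts G \<Longrightarrow> ?q (h v) = ?p v"
    by blast
  have "matching (\<sigma>(x := v)) (\<tau>(x := h v))" if v: "v \<in> pverts G" for v
  proof -
    have hv: "h v \<in> pverts H" using bij_betwE[OF h] v by blast
    have d: "X.gdist (\<sigma> y) v = Y.gdist (\<tau> y) (h v)" "X.gdist (\<sigma> z) v = Y.gdist (\<tau> z) (h v)"
      using hq[OF v] by auto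
    then have d': "X.gdist v (\<sigma> y) = Y.gdist (h v) (\<tau> y)" "X.gdist v (\<sigma> z) = Y.gdist (h v) (\<tau> z)"
      using X.gdist_sym V v Y.gdist_sym hv by metis+
    have d0: "u \<in> pverts G \<Longrightarrow> X.gdist u u = 0" "w \<in> pverts H \<Longrightarrow> Y.gdist w w = 0" for u w
      using X.gdist_eq_0[of u u] Y.gdist_eq_0[of w w] by auto
    \<comment> \<open>The bijection need not track valencies: that of \<open>v\<close> follows from
      the parity of its distance from \<open>\<sigma> y\<close>.\<close>
    have val: "X.valency v = Y.valency (h v)"
      using X.valency_parity[OF S(1) V(1) v] Y.valency_parity[OF S(2) V(2) hv] d V(3) by simp
    have 1: "\<forall>i<3. (\<sigma>(x := v)) i \<in> pverts G \<and> (\<tau>(x := h v)) i \<in> pverts H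
        \<and> X.valency ((\<sigma>(x := v)) i) = Y.valency ((\<tau>(x := h v)) i)"
      using m v hv val by (auto simp: matching_def)
    have 2: "X.gdist ((\<sigma>(x := v)) i) ((\<sigma>(x := v)) j) = Y.gdist ((\<tau>(x := h v)) i) ((\<tau>(x := h v)) j)"
      if "i < 3" "j < 3" for i j
      using yz(5)[OF that(1)] yz(5)[OF that(2)] yz(3,4) V d d' d0 v hv by (elim disjE) simp_all
    show ?thesis unfolding matching_def using 1 2 by blast
  qed
  then show ?thesis using h by blast
qed

lemma matching_sat: "is_C 3 \<phi> \<Longrightarrow> matching \<sigma> \<tau> \<Longrightarrow> sat G \<sigma> \<phi> \<longleftrightarrow> sat H \<tau> \<phi>"
proof (rule sat_invariant[where R = matching])
  fix \<sigma> \<tau> and x y :: nat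
  assume m: "matching \<sigma> \<tau>" and xy: "x < 3" "y < 3"
  then have V: "\<sigma> x \<in> pverts G" "\<sigma> y \<in> pverts G" "\<tau> x \<in> pverts H" "\<tau> y \<in> pverts H"
    and d: "X.gdist (\<sigma> x) (\<sigma> y) = Y.gdist (\<tau> x) (\<tau> y)" by (auto simp: matching_def)
  show "(\<sigma> x = \<sigma> y \<longleftrightarrow> \<tau> x = \<tau> y) \<and> ((\<sigma> x, \<sigma> y) \<in> parcs G \<longleftrightarrow> (\<tau> x, \<tau> y) \<in> parcs H)"
    using X.gdist_eq_0[OF V(1,2)] Y.gdist_eq_0[OF V(3,4)] X.gdist_eq_1[OF V(1,2)] Y.gdist_eq_1[OF V(3,4)] d
      X.arcs_sym Y.arcs_sym by metis
qed (use matching_move in auto)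

end

lemma C3_equivalent: "C_equivalent 3 G H"
proof -
  obtain S where S: "\<And>x y. (x, y) \<in> parcs G \<Longrightarrow> X.valency x + X.valency y = S"
      "\<And>x y. (x, y) \<in> parcs H \<Longrightarrow> Y.valency x + Y.valency y = S"
    and xy: "\<exists>x\<in>pverts G. \<exists>y\<in>pverts H. X.valency x = Y.valency y"
    using valencies_agree by blast
  obtain n where n: "\<And>x y. x \<in> pverts G \<Longrightarrow> y \<in> pverts G \<Longrightarrow> X.gdist x y < n"
    "\<And>x y. x \<in> pverts H \<Longrightarrow> y \<in> pverts H \<Longrightarrow> Y.gdist x y < n"
    using ex_common_bound by blast
  obtain x y where xy: "x \<in> pverts G" "y \<in> pverts H" "X.valency x = Y.valency y" using xy by blast
  \<comment> \<open>Sentences ignore the assignment, so all pebbles may start on one vertex of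
    matching valency.\<close>
  have "matching (\<lambda>_. x) (\<lambda>_. y)"
    unfolding matching_def using xy X.gdist_eq_0[of x x] Y.gdist_eq_0[of y y] by simp
  then have "sat G (\<lambda>_. x) \<phi> \<longleftrightarrow> sat H (\<lambda>_. y) \<phi>" if "is_C 3 \<phi>" for \<phi>
    using matching_sat[OF S n that] by blast
  then show ?thesis
    unfolding C_equivalent_def C_sentence_def using sat_sentence by metis
qed

end

theorem theorem4p5:
  fixes \<Gamma> :: "'a pair_pre_digraph" and \<Delta> :: "'b pair_pre_digraph"
  assumes "distance_regularized_graph \<Gamma>" and "distance_regularized_graph \<Delta>"
  shows "cospectral \<Gamma> \<Delta> \<longleftrightarrow> C_equivalent 3 \<Gamma> \<Delta>"
proof -
  interpret X: distance_regularized_graph \<Gamma> by fact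
  interpret Y: distance_regularized_graph \<Delta> by fact
  have "C_equivalent 3 \<Gamma> \<Delta>" if "\<forall>l. closed_walks \<Gamma> l = closed_walks \<Delta> l"
  proof -
    interpret closed_walk_equivalent \<Gamma> \<Delta> by unfold_locales (use that in blast)
    show ?thesis by (rule C3_equivalent)
  qed
  then show ?thesis
    using cospectral_iff_closed_walks[OF X.pair_finite_verts Y.pair_finite_verts]
      C_equivalent_imp_closed_walks[OF X.pair_finite_verts Y.pair_finite_verts] by blast
qed

end
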